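(* Let $\mathbb{K}$ be a field and let $A$ be an LS algebra with base field $\mathbb{K}$ over a poset with bonds $(S,\leq,\mathfrak{b})$. Then $A$ is Koszul.
   Context: Poset with bonds: $(S,\leq)$ is a finite poset with a unique minimal element and a unique maximal element, and it is graded, i.e. all complete (saturated) chains with the same initial and final elements have the same number of elements. The element $\tau$ covers $\sigma$ if $\sigma<\tau$ and no element lies strictly between them. A set of bonds on $S$ is a map $\mathfrak{b}$ from pairs $(\sigma,\tau)$, with $\tau$ covering $\sigma$, to positive integers such that for any two complete chains $\sigma=\eta_{i,1}<\eta_{i,2}<\cdots<\eta_{i,r}=\tau$, $i=1,2$, from $\sigma$ to $\tau$ one has $\gcd_{1\leq k\leq r-1}\mathfrak{b}(\eta_{1,k},\eta_{1,k+1})=\gcd_{1\leq k\leq r-1}\mathfrak{b}(\eta_{2,k},\eta_{2,k+1})$. For any $\sigma<\tau$, $\mathfrak{b}(\sigma,\tau)$ denotes this common gcd along a complete chain from $\sigma$ to $\tau$. LS-paths: a function $\pi:S\to\mathbb{Q}$ is an LS-path of degree $r\in\mathbb{N}=\{0,1,2,\ldots\}$ if (1) $\pi(\sigma)\geq 0$ for all $\sigma$; (2) $\mathrm{supp}\,\pi=\{\sigma\mid\pi(\sigma)\neq 0\}$ is totally ordered; (3) if $\mathrm{supp}\,\pi=\{\sigma_1<\cdots<\sigma_n\}$, then $\mathfrak{b}(\sigma_j,\sigma_{j+1})\sum_{i=1}^j\pi(\sigma_i)\in\mathbb{N}$ for $j=1,\ldots,n-1$ and $\sum_{i=1}^n\pi(\sigma_i)=r$.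 $\mathrm{LS}_1$ is the (finite) set of LS-paths of degree $1$, $\mathrm{LS}$ the set of all LS-paths. LS-paths have comparable supports if the union of their supports is contained in a chain; then their sum $\dotplus$ as functions on $S$ is an LS-path. Standard monomials: a formal commutative monomial $\pi_1\cdots\pi_r$ of degree $1$ LS-paths is standard if (up to reordering) $\max\mathrm{supp}\,\pi_h\leq\min\mathrm{supp}\,\pi_{h+1}$ for $h=1,\ldots,r-1$. Every LS-path $\pi$ of degree $r$ is uniquely a sum $\pi_{0,1}\dotplus\cdots\dotplus\pi_{0,r}$ with $\pi_{0,1}\cdots\pi_{0,r}$ standard, called the canonical form of $\pi$. Order: given a total order $\leq^t$ on $S$ refining $\leq$, and functions $\pi,\pi':S\to\mathbb{Q}$, write $\pi\leq^t_{\mathrm{rlex}}\pi'$ if $\pi=\pi'$ or $\pi(\sigma)<\pi'(\sigma)$, where $\sigma$ is the $\leq^t$-maximal element with $\pi(\sigma)\neq\pi'(\sigma)$. Write $\pi\trianglelefteq\pi'$ if $\pi\leq^t_{\mathrm{rlex}}\pi'$ for every total order $\leq^t$ refining $\leq$. LS algebra over $(S,\leq,\mathfrak{b})$: a commutative $\mathbb{K}$-algebra $A$ with an injection $j:\mathrm{LS}_1\hookrightarrow A$, extended to $\mathrm{LS}$ by $j(\pi)=j(\pi_{0,1})\cdots j(\pi_{0,r})$ if $\pi_{0,1}\dotplus\cdots\dotplus\pi_{0,r}$ is the canonical form of $\pi$ ($j$ is omitted from the notation), such that: (LSA1) $\mathrm{LS}$ is a $\mathbb{K}$-basis of $A$ and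 the degree of LS-paths induces a grading of the algebra $A$; (LSA2) if $\pi_1\pi_2$ is a non-standard monomial of two degree $1$ LS-paths and $\pi_1\pi_2=\sum_j c_j\pi_{j,1}\pi_{j,2}$ is the unique expression in $A$ as a linear combination of standard monomials (straightening relation), then $\pi_1\dotplus\pi_2\trianglelefteq\pi_{j,1}\dotplus\pi_{j,2}$ whenever $c_j\neq 0$; (LSA3) if $\pi_1\pi_2$ is a non-standard monomial of two degree $1$ LS-paths with comparable supports, then the canonical form of $\pi_1\dotplus\pi_2$ appears with coefficient $1$ in the straightening relation of $\pi_1\pi_2$. Koszul: a graded $\mathbb{K}$-algebra $A=A_0\oplus A_1\oplus\cdots$ with $A_0=\mathbb{K}$, finitely generated in degree $1$, is Koszul if, regarding $\mathbb{K}=A/(A_1\oplus A_2\oplus\cdots)$ as a graded $A$-module, $\mathrm{Tor}_i^A(\mathbb{K},\mathbb{K})$ is concentrated in degree $i$ for every $i\geq 0$. *)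

theory Defs
  imports Complex_Main "HOL-Library.Multiset"
begin

section \<open>Posets with bonds\<close>

definition covers :: "'s::order \<Rightarrow> 's \<Rightarrow> bool" where
  "covers \<tau> \<sigma> \<longleftrightarrow> \<sigma> < \<tau> \<and> \<not> (\<exists>\<rho>. \<sigma> < \<rho> \<and> \<rho> < \<tau>)"

definition complete_chain :: "'s::order \<Rightarrow> 's \<Rightarrow> 's list \<Rightarrow> bool" where
  "complete_chain \<sigma> \<tau> xs \<longleftrightarrow>
     xs \<noteq> [] \<and> hd xs = \<sigma> \<and> last xs = \<tau> \<and> successively (\<lambda>x y. covers y x) xs"

definition chain_gcd :: "('s \<Rightarrow> 's \<Rightarrow> nat) \<Rightarrow> 's list \<Rightarrow> nat" where
  "chain_gcd b xs = Gcd {b (xs ! k) (xs ! Suc k) |k. Suc k < length xs}"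

text \<open>The poset is the whole type \<open>'s\<close>. Only the values \<open>b \<sigma> \<tau>\<close> with \<open>\<tau>\<close> covering \<open>\<sigma>\<close> matter.\<close>

locale poset_with_bonds =
  fixes b :: "'s::{finite,order} \<Rightarrow> 's \<Rightarrow> nat"
  assumes unique_minimal: "\<exists>!x::'s. \<forall>y. \<not> y < x"
    and unique_maximal: "\<exists>!x::'s. \<forall>y. \<not> x < y"
    and graded: "\<And>(\<sigma>::'s) \<tau> xs ys. complete_chain \<sigma> \<tau> xs \<Longrightarrow> complete_chain \<sigma> \<tau> ys
                   \<Longrightarrow> length xs = length ys"
    and bond_pos: "\<And>\<sigma> \<tau>. covers \<tau> \<sigma> \<Longrightarrow> 0 < b \<sigma> \<tau>"
    and bond_gcd: "\<And>\<sigma> \<tau> xs ys. complete_chain \<sigma> \<tau> xs \<Longrightarrow> complete_chain \<sigma> \<tau> ys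
                   \<Longrightarrow> chain_gcd b xs = chain_gcd b ys"

definition bond :: "('s::order \<Rightarrow> 's \<Rightarrow> nat) \<Rightarrow> 's \<Rightarrow> 's \<Rightarrow> nat" where
  "bond b \<sigma> \<tau> = (THE g. \<exists>xs. complete_chain \<sigma> \<tau> xs \<and> g = chain_gcd b xs)"


section \<open>LS-paths and standard monomials\<close>

definition supp :: "('s \<Rightarrow> rat) \<Rightarrow> 's set" where
  "supp \<pi> = {\<sigma>. \<pi> \<sigma> \<noteq> 0}"

definition totally_ordered :: "'s::order set \<Rightarrow> bool" where
  "totally_ordered X \<longleftrightarrow> (\<forall>\<sigma>\<in>X. \<forall>\<tau>\<in>X. \<sigma> \<le> \<tau> \<or> \<tau> \<le> \<sigma>)"

text \<open>The list \<open>xs\<close> below is the increasing enumeration of the support, indexed from 0.\<close>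

definition ls_path :: "('s::order \<Rightarrow> 's \<Rightarrow> nat) \<Rightarrow> nat \<Rightarrow> ('s \<Rightarrow> rat) \<Rightarrow> bool" where
  "ls_path b r \<pi> \<longleftrightarrow>
     (\<forall>\<sigma>. 0 \<le> \<pi> \<sigma>) \<and>
     totally_ordered (supp \<pi>) \<and>
     (\<exists>xs. set xs = supp \<pi> \<and> sorted_wrt (<) xs \<and>
        (\<forall>k. Suc k < length xs \<longrightarrow>
           of_nat (bond b (xs ! k) (xs ! Suc k)) * (\<Sum>i\<le>k. \<pi> (xs ! i)) \<in> \<nat>) \<and>
        (\<Sum>i<length xs. \<pi> (xs ! i)) = of_nat r)"

definition LS_deg :: "('s::order \<Rightarrow> 's \<Rightarrow> nat) \<Rightarrow> nat \<Rightarrow> ('s \<Rightarrow> rat) set" where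
  "LS_deg b r = {\<pi>. ls_path b r \<pi>}"

definition LS :: "('s::order \<Rightarrow> 's \<Rightarrow> nat) \<Rightarrow> ('s \<Rightarrow> rat) set" where
  "LS b = (\<Union>r. LS_deg b r)"

definition comparable_supports :: "('s::order \<Rightarrow> rat) \<Rightarrow> ('s \<Rightarrow> rat) \<Rightarrow> bool" where
  "comparable_supports \<pi> \<pi>' \<longleftrightarrow> (\<exists>C. totally_ordered C \<and> supp \<pi> \<union> supp \<pi>' \<subseteq> C)"

definition max_supp :: "('s::order \<Rightarrow> rat) \<Rightarrow> 's" where
  "max_supp \<pi> = (GREATEST \<sigma>. \<sigma> \<in> supp \<pi>)"

definition min_supp :: "('s::order \<Rightarrow> rat) \<Rightarrow> 's" where
  "min_supp \<pi> = (LEAST \<sigma>. \<sigma> \<in> supp \<pi>)"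

text \<open>Formal commutative monomials in the LS-paths of degree 1 are multisets; the degree of a
  monomial is the size of the multiset, and the empty monomial is standard.\<close>

definition standard :: "('s::order \<Rightarrow> 's \<Rightarrow> nat) \<Rightarrow> ('s \<Rightarrow> rat) multiset \<Rightarrow> bool" where
  "standard b M \<longleftrightarrow> set_mset M \<subseteq> LS_deg b 1 \<and>
     (\<exists>ps. mset ps = M \<and> successively (\<lambda>p q. max_supp p \<le> min_supp q) ps)"

definition path_sum :: "('s \<Rightarrow> rat) multiset \<Rightarrow> 's \<Rightarrow> rat" where
  "path_sum M = (\<lambda>\<sigma>. \<Sum>p\<in>#M. p \<sigma>)"

definition canonical_form ::
    "('s::order \<Rightarrow> 's \<Rightarrow> nat) \<Rightarrow> ('s \<Rightarrow> rat) \<Rightarrow> ('s \<Rightarrow> rat) multiset" where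
  "canonical_form b \<pi> = (THE M. standard b M \<and> path_sum M = \<pi>)"


section \<open>The order on functions\<close>

definition refines_order :: "'s::order rel \<Rightarrow> bool" where
  "refines_order t \<longleftrightarrow> linear_order t \<and> (\<forall>x y. x \<le> y \<longrightarrow> (x, y) \<in> t)"

definition rlex_le :: "'s rel \<Rightarrow> ('s \<Rightarrow> rat) \<Rightarrow> ('s \<Rightarrow> rat) \<Rightarrow> bool" where
  "rlex_le t \<pi> \<pi>' \<longleftrightarrow> \<pi> = \<pi>' \<or>
     (\<exists>\<sigma>. \<pi> \<sigma> < \<pi>' \<sigma> \<and> (\<forall>\<tau>. \<pi> \<tau> \<noteq> \<pi>' \<tau> \<longrightarrow> (\<tau>, \<sigma>) \<in> t))"

definition path_le :: "('s::order \<Rightarrow> rat) \<Rightarrow> ('s \<Rightarrow> rat) \<Rightarrow> bool" where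
  "path_le \<pi> \<pi>' \<longleftrightarrow> (\<forall>t. refines_order t \<longrightarrow> rlex_le t \<pi> \<pi>')"


section \<open>Graded commutative algebras over a field\<close>

locale comm_algebra = vector_space scale
  for scale :: "'k::field \<Rightarrow> 'a::comm_ring_1 \<Rightarrow> 'a" +
  assumes scale_mult: "scale c (x * y) = scale c x * y"

locale graded_comm_algebra = comm_algebra scale
  for scale :: "'k::field \<Rightarrow> 'a::comm_ring_1 \<Rightarrow> 'a" +
  fixes A :: "nat \<Rightarrow> 'a set"
  assumes component_subspace: "subspace (A n)"
    and direct_sum: "\<exists>!f. (\<forall>n. f n \<in> A n) \<and> finite {n. f n \<noteq> 0} \<and> x = (\<Sum>n | f n \<noteq> 0. f n)"
    and one_component: "1 \<in> A 0"
    and mult_component: "x \<in> A m \<Longrightarrow> y \<in> A n \<Longrightarrow> x * y \<in> A (m + n)"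

definition connected_graded ::
    "('k::field \<Rightarrow> 'a::comm_ring_1 \<Rightarrow> 'a) \<Rightarrow> (nat \<Rightarrow> 'a set) \<Rightarrow> bool" where
  "connected_graded scale A \<longleftrightarrow> A 0 = range (\<lambda>c. scale c 1)"

definition finitely_generated_deg1 ::
    "('k::field \<Rightarrow> 'a::comm_ring_1 \<Rightarrow> 'a) \<Rightarrow> (nat \<Rightarrow> 'a set) \<Rightarrow> bool" where
  "finitely_generated_deg1 scale A \<longleftrightarrow>
     (\<exists>G. finite G \<and> G \<subseteq> A 1 \<and>
        module.span scale {\<Prod>x\<in>#M. x |M. set_mset M \<subseteq> G} = UNIV)"

definition irrelevant_ideal ::
    "('k::field \<Rightarrow> 'a::comm_ring_1 \<Rightarrow> 'a) \<Rightarrow> (nat \<Rightarrow> 'a set) \<Rightarrow> 'a set" where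
  "irrelevant_ideal scale A = module.span scale (\<Union>n\<in>{1..}. A n)"

text \<open>The quotient map from \<open>A\<close> to \<open>A / (A\<^sub>1 \<oplus> A\<^sub>2 \<oplus> \<dots>) = \<bbbK>\<close>, for a graded algebra with
  \<open>A\<^sub>0 = \<bbbK>\<close>. The field is an \<open>A\<close>-module, placed in degree 0, through this map.\<close>

definition augmentation ::
    "('k::field \<Rightarrow> 'a::comm_ring_1 \<Rightarrow> 'a) \<Rightarrow> (nat \<Rightarrow> 'a set) \<Rightarrow> 'a \<Rightarrow> 'k" where
  "augmentation scale A x = (THE c. x - scale c 1 \<in> irrelevant_ideal scale A)"


section \<open>Graded free resolutions, Tor and Koszul algebras\<close>

text \<open>The free \<open>R\<close>-module on a set \<open>X\<close> of basis labels consists of the finitely supported functions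
  on \<open>X\<close>, extended by 0. A linear map between free modules is given by the images \<open>D e\<close> of the
  basis elements.\<close>

definition free_module :: "'e set \<Rightarrow> ('e \<Rightarrow> 'r::comm_ring_1) set" where
  "free_module X = {f. finite {e. f e \<noteq> 0} \<and> {e. f e \<noteq> 0} \<subseteq> X}"

definition lin_ext ::
    "('e \<Rightarrow> 'f \<Rightarrow> 'r::comm_ring_1) \<Rightarrow> ('e \<Rightarrow> 'r) \<Rightarrow> 'f \<Rightarrow> 'r" where
  "lin_ext D f = (\<lambda>e'. \<Sum>e | f e \<noteq> 0. f e * D e e')"

text \<open>The homogeneous elements of degree \<open>n\<close> of the graded free module on a basis \<open>X\<close> whose
  elements \<open>e\<close> have degree \<open>d e\<close>.\<close>

definition free_component ::
    "(nat \<Rightarrow> 'r::comm_ring_1 set) \<Rightarrow> 'e set \<Rightarrow> ('e \<Rightarrow> nat) \<Rightarrow> nat \<Rightarrow> ('e \<Rightarrow> 'r) set" where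
  "free_component A X d n =
     {f \<in> free_module X. \<forall>e. f e \<noteq> 0 \<longrightarrow> d e \<le> n \<and> f e \<in> A (n - d e)}"

text \<open>A graded free resolution of \<open>\<bbbK>\<close> over \<open>A\<close>: the module in homological degree \<open>i\<close> is free on
  \<open>X i\<close> with degrees \<open>d i\<close>, the differential from homological degree \<open>i + 1\<close> to \<open>i\<close> is
  \<open>lin_ext (D i)\<close>, and \<open>\<eta>\<close> gives the images of the basis elements under the map onto \<open>\<bbbK>\<close>.
  Labels in \<open>nat\<close> suffice: if \<open>A\<close> is finitely generated in degree 1 with \<open>A\<^sub>0 = \<bbbK>\<close>, then the
  components of \<open>A\<close> are finite-dimensional, so \<open>\<bbbK>\<close> has resolutions with countable bases.\<close>

locale graded_free_resolution = graded_comm_algebra scale A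
  for scale :: "'k::field \<Rightarrow> 'a::comm_ring_1 \<Rightarrow> 'a" and A :: "nat \<Rightarrow> 'a set" +
  fixes X :: "nat \<Rightarrow> nat set"
    and d :: "nat \<Rightarrow> nat \<Rightarrow> nat"
    and D :: "nat \<Rightarrow> nat \<Rightarrow> nat \<Rightarrow> 'a"
    and \<eta> :: "nat \<Rightarrow> 'k"
  assumes differential_degree:
      "e \<in> X (Suc i) \<Longrightarrow> D i e \<in> free_component A (X i) (d i) (d (Suc i) e)"
    and augmentation_degree: "e \<in> X 0 \<Longrightarrow> \<eta> e \<noteq> 0 \<Longrightarrow> d 0 e = 0"
    and exact_field:
      "(\<lambda>f. \<Sum>e | f e \<noteq> 0. augmentation scale A (f e) * \<eta> e) ` free_module (X 0) = UNIV"
    and exact_0: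
      "lin_ext (D 0) ` free_module (X 1) =
         {f \<in> free_module (X 0). (\<Sum>e | f e \<noteq> 0. augmentation scale A (f e) * \<eta> e) = 0}"
    and exact_Suc:
      "lin_ext (D (Suc i)) ` free_module (X (Suc (Suc i))) =
         {f \<in> free_module (X (Suc i)). lin_ext (D i) f = (\<lambda>_. 0)}"

text \<open>Tensoring the free \<open>A\<close>-module on \<open>X i\<close> with \<open>\<bbbK>\<close> gives the vector space on \<open>X i\<close>, with the
  same degrees of basis elements, and the induced differential has the augmented matrix entries.
  \<open>Tor_i\<close> in internal degree \<open>n\<close> is the homology of the resulting complex.\<close>

definition tensor_component ::
    "(nat \<Rightarrow> nat set) \<Rightarrow> (nat \<Rightarrow> nat \<Rightarrow> nat) \<Rightarrow> nat \<Rightarrow> nat \<Rightarrow> (nat \<Rightarrow> 'k::field) set" where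
  "tensor_component X d i n = free_module {e \<in> X i. d i e = n}"

definition tensor_differential ::
    "('k::field \<Rightarrow> 'a::comm_ring_1 \<Rightarrow> 'a) \<Rightarrow> (nat \<Rightarrow> 'a set) \<Rightarrow> (nat \<Rightarrow> nat \<Rightarrow> nat \<Rightarrow> 'a)
       \<Rightarrow> nat \<Rightarrow> (nat \<Rightarrow> 'k) \<Rightarrow> nat \<Rightarrow> 'k" where
  "tensor_differential scale A D i = lin_ext (\<lambda>e e'. augmentation scale A (D i e e'))"

definition tor_cycles ::
    "('k::field \<Rightarrow> 'a::comm_ring_1 \<Rightarrow> 'a) \<Rightarrow> (nat \<Rightarrow> 'a set) \<Rightarrow> (nat \<Rightarrow> nat set) \<Rightarrow> (nat \<Rightarrow> nat \<Rightarrow> nat)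
       \<Rightarrow> (nat \<Rightarrow> nat \<Rightarrow> nat \<Rightarrow> 'a) \<Rightarrow> nat \<Rightarrow> nat \<Rightarrow> (nat \<Rightarrow> 'k) set" where
  "tor_cycles scale A X d D i n =
     {v \<in> tensor_component X d i n.
        \<forall>m. i = Suc m \<longrightarrow> tensor_differential scale A D m v = (\<lambda>_. 0)}"

definition tor_boundaries ::
    "('k::field \<Rightarrow> 'a::comm_ring_1 \<Rightarrow> 'a) \<Rightarrow> (nat \<Rightarrow> 'a set) \<Rightarrow> (nat \<Rightarrow> nat set) \<Rightarrow> (nat \<Rightarrow> nat \<Rightarrow> nat)
       \<Rightarrow> (nat \<Rightarrow> nat \<Rightarrow> nat \<Rightarrow> 'a) \<Rightarrow> nat \<Rightarrow> nat \<Rightarrow> (nat \<Rightarrow> 'k) set" where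
  "tor_boundaries scale A X d D i n =
     tensor_differential scale A D i ` tensor_component X d (Suc i) n"

definition tor ::
    "('k::field \<Rightarrow> 'a::comm_ring_1 \<Rightarrow> 'a) \<Rightarrow> (nat \<Rightarrow> 'a set) \<Rightarrow> (nat \<Rightarrow> nat set) \<Rightarrow> (nat \<Rightarrow> nat \<Rightarrow> nat)
       \<Rightarrow> (nat \<Rightarrow> nat \<Rightarrow> nat \<Rightarrow> 'a) \<Rightarrow> nat \<Rightarrow> nat \<Rightarrow> (nat \<Rightarrow> 'k) set set" where
  "tor scale A X d D i n =
     tor_cycles scale A X d D i n //
       {(u, v). u \<in> tor_cycles scale A X d D i n \<and> v \<in> tor_cycles scale A X d D i n \<and>
                (\<lambda>e. u e - v e) \<in> tor_boundaries scale A X d D i n}"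

text \<open>A quotient space is zero iff it is a singleton. Since Tor does not depend on the chosen
  graded free resolution, it may be computed with any one of them.\<close>

definition koszul ::
    "('k::field \<Rightarrow> 'a::comm_ring_1 \<Rightarrow> 'a) \<Rightarrow> (nat \<Rightarrow> 'a set) \<Rightarrow> bool" where
  "koszul scale A \<longleftrightarrow>
     graded_comm_algebra scale A \<and> connected_graded scale A \<and> finitely_generated_deg1 scale A \<and>
     (\<exists>X d D \<eta>. graded_free_resolution scale A X d D \<eta> \<and>
        (\<forall>i n. n \<noteq> i \<longrightarrow> is_singleton (tor scale A X d D i n)))"


section \<open>LS algebras\<close>

definition monomial_value ::
    "(('s \<Rightarrow> rat) \<Rightarrow> 'a::comm_ring_1) \<Rightarrow> ('s \<Rightarrow> rat) multiset \<Rightarrow> 'a" where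
  "monomial_value j M = (\<Prod>p\<in>#M. j p)"

definition path_value ::
    "('s::order \<Rightarrow> 's \<Rightarrow> nat) \<Rightarrow> (('s \<Rightarrow> rat) \<Rightarrow> 'a::comm_ring_1) \<Rightarrow> ('s \<Rightarrow> rat) \<Rightarrow> 'a" where
  "path_value b j \<pi> = monomial_value j (canonical_form b \<pi>)"

definition ls_component ::
    "('k::field \<Rightarrow> 'a::comm_ring_1 \<Rightarrow> 'a) \<Rightarrow> ('s::order \<Rightarrow> 's \<Rightarrow> nat)
       \<Rightarrow> (('s \<Rightarrow> rat) \<Rightarrow> 'a) \<Rightarrow> nat \<Rightarrow> 'a set" where
  "ls_component scale b j r = module.span scale (path_value b j ` LS_deg b r)"

text \<open>The function \<open>c\<close> holds the coefficients of an expression of \<open>j \<pi>\<^sub>1 * j \<pi>\<^sub>2\<close> as a linear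
  combination of standard monomials of degree 2.\<close>

definition straightening ::
    "('k::field \<Rightarrow> 'a::comm_ring_1 \<Rightarrow> 'a) \<Rightarrow> ('s::order \<Rightarrow> 's \<Rightarrow> nat) \<Rightarrow> (('s \<Rightarrow> rat) \<Rightarrow> 'a)
       \<Rightarrow> ('s \<Rightarrow> rat) \<Rightarrow> ('s \<Rightarrow> rat) \<Rightarrow> (('s \<Rightarrow> rat) multiset \<Rightarrow> 'k) \<Rightarrow> bool" where
  "straightening scale b j \<pi>\<^sub>1 \<pi>\<^sub>2 c \<longleftrightarrow>
     finite {M. c M \<noteq> 0} \<and> (\<forall>M. c M \<noteq> 0 \<longrightarrow> standard b M \<and> size M = 2) \<and>
     j \<pi>\<^sub>1 * j \<pi>\<^sub>2 = (\<Sum>M | c M \<noteq> 0. scale (c M) (monomial_value j M))"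

text \<open>The map \<open>j\<close> is only used on LS-paths of degree 1; its extension to all LS-paths is
  \<open>path_value b j\<close>. Straightening relations exist and are unique by the first two groups of
  assumptions.\<close>

locale ls_algebra = comm_algebra scale + poset_with_bonds b
  for scale :: "'k::field \<Rightarrow> 'a::comm_ring_1 \<Rightarrow> 'a"
    and b :: "'s::{finite,order} \<Rightarrow> 's \<Rightarrow> nat" +
  fixes j :: "('s \<Rightarrow> rat) \<Rightarrow> 'a"
  assumes inj_j: "inj_on j (LS_deg b 1)"
    and LSA1_inj: "inj_on (path_value b j) (LS b)"
    and LSA1_independent: "independent (path_value b j ` LS b)"
    and LSA1_span: "span (path_value b j ` LS b) = UNIV"
    and LSA1_grading: "graded_comm_algebra scale (ls_component scale b j)"
    and LSA2: "\<And>\<pi>\<^sub>1 \<pi>\<^sub>2 c M. \<pi>\<^sub>1 \<in> LS_deg b 1 \<Longrightarrow> \<pi>\<^sub>2 \<in> LS_deg b 1 \<Longrightarrow> \<not> standard b {#\<pi>\<^sub>1, \<pi>\<^sub>2#}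
        \<Longrightarrow> straightening scale b j \<pi>\<^sub>1 \<pi>\<^sub>2 c \<Longrightarrow> c M \<noteq> 0
        \<Longrightarrow> path_le (path_sum {#\<pi>\<^sub>1, \<pi>\<^sub>2#}) (path_sum M)"
    and LSA3: "\<And>\<pi>\<^sub>1 \<pi>\<^sub>2 c. \<pi>\<^sub>1 \<in> LS_deg b 1 \<Longrightarrow> \<pi>\<^sub>2 \<in> LS_deg b 1 \<Longrightarrow> \<not> standard b {#\<pi>\<^sub>1, \<pi>\<^sub>2#}
        \<Longrightarrow> comparable_supports \<pi>\<^sub>1 \<pi>\<^sub>2 \<Longrightarrow> straightening scale b j \<pi>\<^sub>1 \<pi>\<^sub>2 c
        \<Longrightarrow> c (canonical_form b (path_sum {#\<pi>\<^sub>1, \<pi>\<^sub>2#})) = 1"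

end

theory Submission
  imports Defs "HOL-Library.Countable" "HOL-Library.Function_Algebras"
begin

text \<open>
  The proof exhibits \<open>A\<close> as a quadratic algebra with a Poincare--Birkhoff--Witt basis and resolves
  the field by Anick's construction, which for such algebras is linear.

  Take the LS-paths of degree 1 as letters and call a word normal if every two neighbours \<open>p\<close>, \<open>q\<close>
  satisfy \<open>max supp p \<le> min supp q\<close>. Normal words are the standard monomials written in increasing
  order. Cutting an LS-path of degree \<open>r\<close> into unit pieces, from the top downwards, and adding up
  the letters of a word are inverse to each other (\<open>path_has_normal_word\<close>, \<open>sum_list_path\<close>,
  \<open>normal_word_unique\<close>), so the values of the normal words are a basis of \<open>A\<close>.

  Normality only looks at neighbours. Hence every word can be rewritten into normal ones by
  quadratic relations, as soon as replacing a bad pair goes strictly down in an order on words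
  that is compatible with concatenation (\<open>straighten_words\<close>). In this order a word is low if its
  total sum is reverse lexicographically large: by the second axiom of LS algebras the sum never
  gets smaller under straightening. When the sum stays the same, the normal word is the one
  whose last letter took as much mass from the top as a unit path can take
  (\<open>rlex_greatest_part\<close>), so a position-weighted sum grows. One linear extension of the poset is
  enough for this, and it is fixed once and for all.

  For an algebra with such a basis, the \<open>i\<close>-th module of the resolution is free on the chains, the
  words of length \<open>i\<close> in which every pair of neighbours is bad. Over the field it has the basis
  \<open>e\<^sub>c u\<close> with \<open>c\<close> a chain and \<open>u\<close> a normal word, ordered by the word \<open>cu\<close>. The differentials have the form
  \<open>e\<^bsub>cp\<^esub> \<mapsto> p e\<^sub>c + lower terms\<close>. If the first letter \<open>p\<close> of \<open>u = p u'\<close> extends the chain \<open>c\<close>, then \<open>e\<^sub>c u\<close> is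
  the leading term of the boundary of \<open>e\<^bsub>cp\<^esub> u'\<close>; otherwise call \<open>e\<^sub>c u\<close> reduced. Shifting that letter is a
  bijection from the reduced basis elements in degree \<open>i + 1\<close> to the non-reduced ones in degree \<open>i\<close>.
  Therefore every element is a boundary plus a combination of reduced ones (\<open>reduce\<close>), and the
  differential, or the augmentation in degree 0, is injective on the latter (\<open>reduced_kernel\<close>,
  \<open>reduced_0\<close>). These two facts give exactness, and
  they also provide the lower terms of the next differential (\<open>extend_differential\<close>). As the order on words
  respects length, all matrix entries lie in degree 1, so the \<open>i\<close>-th module is generated in degree
  \<open>i\<close> and Tor vanishes off the diagonal (\<open>pbw_algebra.koszul\<close>).
\<close>

section \<open>Words and finitely supported functions\<close>

definition normal_words :: "'w set \<Rightarrow> ('w \<Rightarrow> 'w \<Rightarrow> bool) \<Rightarrow> 'w list set" where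
  "normal_words W good = {u. set u \<subseteq> W \<and> successively good u}"

definition word_value :: "('w \<Rightarrow> 'a::comm_ring_1) \<Rightarrow> 'w list \<Rightarrow> 'a" where
  "word_value x u = prod_list (map x u)"

lemma word_value_simps [simp]:
  "word_value x [] = 1"
  "word_value x (p # u) = x p * word_value x u"
  "word_value x (u @ v) = word_value x u * word_value x v"
  by (simp_all add: word_value_def)

definition single :: "'e \<Rightarrow> 'a::zero \<Rightarrow> 'e \<Rightarrow> 'a" where
  "single e a = (\<lambda>e'. if e' = e then a else 0)"

lemma single_add: "single e (a + a') = single e a + single e (a'::'a::comm_monoid_add)"
  by (auto simp: single_def fun_eq_iff)

lemma supp_single: "{e'. single e a e' \<noteq> 0} = (if a = 0 then {} else {e})"
  by (auto simp: single_def)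

lemma finite_supp_add:
  "finite {e. f e \<noteq> 0} \<Longrightarrow> finite {e. g e \<noteq> 0} \<Longrightarrow> finite {e. (f + g) e \<noteq> (0::'a::comm_ring_1)}"
  by (rule finite_subset[of _ "{e. f e \<noteq> 0} \<union> {e. g e \<noteq> 0}"]) auto

lemma lin_ext_eq:
  assumes "finite S" "{e. f e \<noteq> 0} \<subseteq> S"
  shows "lin_ext D f e' = (\<Sum>e\<in>S. f e * D e e')"
  unfolding lin_ext_def using assms by (intro sum.mono_neutral_left) auto

lemma lin_ext_add:
  assumes "finite {e. f e \<noteq> 0}" "finite {e. g e \<noteq> 0}"
  shows "lin_ext D (f + g) = lin_ext D f + lin_ext D g"
proof
  fix e'
  let ?S = "{e. f e \<noteq> 0} \<union> {e. g e \<noteq> 0}"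
  have fin: "finite ?S" using assms by simp
  have "{e. (f + g) e \<noteq> 0} \<subseteq> ?S" by auto
  then show "lin_ext D (f + g) e' = (lin_ext D f + lin_ext D g) e'"
    by (simp add: lin_ext_eq[OF fin, where e' = e'] distrib_right sum.distrib)
qed

lemma lin_ext_mult:
  assumes "finite {e. f e \<noteq> 0}"
  shows "lin_ext D (\<lambda>e. a * f e) = (\<lambda>e'. a * lin_ext D f e')"
proof
  fix e'
  have "lin_ext D (\<lambda>e. a * f e) e' = (\<Sum>e\<in>{e. f e \<noteq> 0}. a * f e * D e e')"
    using assms by (intro lin_ext_eq) auto
  also have "\<dots> = a * lin_ext D f e'"
    by (simp add: lin_ext_def sum_distrib_left mult.assoc)
  finally show "lin_ext D (\<lambda>e. a * f e) e' = a * lin_ext D f e'" .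
qed

lemma lin_ext_single: "lin_ext D (single e a) = (\<lambda>e'. a * D e e')"
  by (simp add: lin_ext_def supp_single) (simp add: single_def fun_eq_iff)

lemma lin_ext_zero: "lin_ext D 0 = 0"
  by (simp add: lin_ext_def fun_eq_iff)

lemma lin_ext_comp_zero:
  fixes D :: "'e \<Rightarrow> 'f \<Rightarrow> 'a::comm_ring_1" and D' :: "'g \<Rightarrow> 'e \<Rightarrow> 'a"
  assumes fin: "finite {g. f g \<noteq> 0}"
    and zero: "\<And>g. f g \<noteq> 0 \<Longrightarrow> lin_ext D (D' g) = 0"
    and fin': "\<And>g. f g \<noteq> 0 \<Longrightarrow> finite {e. D' g e \<noteq> 0}"
  shows "lin_ext D (lin_ext D' f) = 0"
proof -
  have "finite {e. (\<lambda>e. \<Sum>g\<in>S. f g * D' g e) e \<noteq> 0} \<and> lin_ext D (\<lambda>e. \<Sum>g\<in>S. f g * D' g e) = 0"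
    if "finite S" "S \<subseteq> {g. f g \<noteq> 0}" for S
    using that
  proof (induction S rule: finite_induct)
    case empty
    then show ?case using lin_ext_zero[of D] by (simp add: zero_fun_def)
  next
    case (insert h S)
    have h: "finite {e. f h * D' h e \<noteq> 0}"
      by (rule finite_subset[OF _ fin'[of h]]) (use insert in auto)
    have "(\<lambda>e. \<Sum>g\<in>insert h S. f g * D' g e) = (\<lambda>e. f h * D' h e) + (\<lambda>e. \<Sum>g\<in>S. f g * D' g e)"
      using insert by (simp add: plus_fun_def)
    moreover have "lin_ext D (\<lambda>e. f h * D' h e) = 0"
      using insert zero[of h] fin'[of h] by (simp add: lin_ext_mult fun_eq_iff)
    ultimately show ?case
      using insert h finite_supp_add[OF h] by (simp add: lin_ext_add)
  qed
  from this[OF fin] show ?thesis by (simp add: lin_ext_def[of D'])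
qed

section \<open>Graded algebras with a basis of normal words\<close>

text \<open>The order on words is a partial order. Since it preserves length, it is well-founded on words
  over the finite alphabet. Only pairs are assumed to straighten; this is what makes the algebra quadratic.\<close>

locale pbw_algebra = graded_comm_algebra scale A
  for scale :: "'k::field \<Rightarrow> 'a::comm_ring_1 \<Rightarrow> 'a" and A :: "nat \<Rightarrow> 'a set" +
  fixes W :: "'w::countable set"
    and x :: "'w \<Rightarrow> 'a"
    and good :: "'w \<Rightarrow> 'w \<Rightarrow> bool"
    and lt :: "'w list \<Rightarrow> 'w list \<Rightarrow> bool"  (infix "\<prec>" 50)
  assumes finite_letters: "finite W"
    and lt_irrefl: "\<not> u \<prec> u"
    and lt_trans: "u \<prec> v \<Longrightarrow> v \<prec> w \<Longrightarrow> u \<prec> w"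
    and lt_length: "u \<prec> v \<Longrightarrow> length u = length v"
    and lt_context: "u \<prec> v \<Longrightarrow> a @ u @ b \<prec> a @ v @ b"
    and inj_value: "inj_on (word_value x) (normal_words W good)"
    and independent_values: "independent (word_value x ` normal_words W good)"
    and span_values: "span (word_value x ` normal_words W good) = UNIV"
    and component_eq: "A n = span (word_value x ` {u \<in> normal_words W good. length u = n})"
    and straighten: "p \<in> W \<Longrightarrow> q \<in> W \<Longrightarrow> \<not> good p q
       \<Longrightarrow> x p * x q \<in> span (word_value x ` {u \<in> normal_words W good. u \<prec> [p, q]})"
begin

abbreviation "val \<equiv> word_value x"
abbreviation "N \<equiv> normal_words W good"

lemma lt_append_left: "u \<prec> v \<Longrightarrow> a @ u \<prec> a @ v"
  using lt_context[of u v a "[]"] by simp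

lemma lt_append_right: "u \<prec> v \<Longrightarrow> u @ b \<prec> v @ b"
  using lt_context[of u v "[]" b] by simp

lemma normal_Nil [simp]: "[] \<in> N"
  by (simp add: normal_words_def)

text \<open>Strictly monotone, hence a measure for induction along the order on words.\<close>

definition rank :: "'w list \<Rightarrow> nat" where
  "rank w = card {v. set v \<subseteq> W \<and> v \<prec> w}"

lemma rank_less:
  assumes "set v \<subseteq> W" "v \<prec> w"
  shows "rank v < rank w"
  unfolding rank_def
proof (rule psubset_card_mono)
  show "finite {v. set v \<subseteq> W \<and> v \<prec> w}"
    by (rule finite_subset[OF _ finite_lists_length_eq[OF finite_letters, of "length w"]])
      (use lt_length in auto)
  show "{u. set u \<subseteq> W \<and> u \<prec> v} \<subset> {u. set u \<subseteq> W \<and> u \<prec> w}"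
    using assms lt_trans lt_irrefl by blast
qed

lemma scale_as_mult: "scale c y = scale c 1 * y"
  using scale_mult[of c 1 y] by simp

lemma mult_scale: "y * scale c z = scale c (y * z)"
  by (metis mult.commute scale_mult)

lemma subspace_mult: "subspace S \<Longrightarrow> subspace {y. a * y \<in> S}"
  unfolding subspace_def by (auto simp: mult_scale distrib_left)

section \<open>Normal forms\<close>

text \<open>A word that is not normal contains a bad pair of neighbours. Straightening that pair in
  context gives lower words, to which the induction applies.\<close>

lemma value_non_normal:
  assumes "set w \<subseteq> W" "w \<notin> N"
  shows "val w \<in> span (val ` {u \<in> N. u \<prec> w})"
  using assms
proof (induction "rank w" arbitrary: w rule: less_induct)
  case less
  have "\<not> successively good w \<Longrightarrow> \<exists>a p q b. w = a @ [p, q] @ b \<and> \<not> good p q" for w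
  proof (induction good w rule: successively.induct)
    case (3 P p q u)
    show ?case
    proof (cases "P p q")
      case True
      then obtain a p' q' b where "q # u = a @ [p', q'] @ b \<and> \<not> P p' q'"
        using 3 by auto
      then have "p # q # u = (p # a) @ [p', q'] @ b \<and> \<not> P p' q'" by simp
      then show ?thesis by blast
    next
      case False
      then show ?thesis by (metis append_Cons append_Nil)
    qed
  qed auto
  then obtain a p q b where w: "w = a @ [p, q] @ b" and bad: "\<not> good p q"
    using less.prems unfolding normal_words_def by blast
  let ?S = "span (val ` {u \<in> N. u \<prec> w})"
  have "span (val ` {u \<in> N. u \<prec> [p, q]}) \<subseteq> {y. (val a * val b) * y \<in> ?S}"
  proof (rule span_minimal[OF _ subspace_mult[OF subspace_span]], rule image_subsetI)
    fix u assume "u \<in> {u \<in> N. u \<prec> [p, q]}"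
    then have u: "u \<in> N" "u \<prec> [p, q]" by auto
    let ?v = "a @ u @ b"
    have lt: "?v \<prec> w" using lt_context[OF u(2)] w by simp
    have set: "set ?v \<subseteq> W" using u less.prems(1) w by (auto simp: normal_words_def)
    have "val ?v \<in> ?S"
    proof (cases "?v \<in> N")
      case True
      then show ?thesis using lt by (intro span_base imageI) simp
    next
      case False
      have "val ?v \<in> span (val ` {u \<in> N. u \<prec> ?v})"
        by (rule less.hyps[OF rank_less[OF set lt] set False])
      also have "\<dots> \<subseteq> ?S"
        using lt lt_trans by (intro span_mono) blast
      finally show ?thesis .
    qed
    then show "val u \<in> {y. (val a * val b) * y \<in> ?S}"
      by (simp add: mult_ac)
  qed
  then have "(val a * val b) * (x p * x q) \<in> ?S"
    using straighten[OF _ _ bad] less.prems(1) w by auto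
  then show ?case using w by (simp add: mult_ac)
qed

lemma value_in_span:
  assumes "set w \<subseteq> W"
  shows "val w \<in> span (val ` {u \<in> N. u = w \<or> u \<prec> w})"
proof (cases "w \<in> N")
  case True
  then show ?thesis by (intro span_base) auto
next
  case False
  have "span (val ` {u \<in> N. u \<prec> w}) \<subseteq> span (val ` {u \<in> N. u = w \<or> u \<prec> w})"
    by (intro span_mono) auto
  then show ?thesis using value_non_normal[OF assms False] by blast
qed

definition coord :: "'w list \<Rightarrow> 'a \<Rightarrow> 'k" where
  "coord u a = representation (val ` N) a (val u)"

lemma coord_add [simp]: "coord u (a + a') = coord u a + coord u a'"
  by (simp add: coord_def representation_add independent_values span_values)

lemma coord_scale [simp]: "coord u (scale c a) = c * coord u a"
  by (simp add: coord_def representation_scale independent_values span_values)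

lemma coord_zero [simp]: "coord u 0 = 0"
  by (simp add: coord_def representation_zero)

lemma coord_diff [simp]: "coord u (a - a') = coord u a - coord u a'"
  using coord_add[of u "a - a'" a'] by simp

lemma coord_val:
  assumes "u \<in> N" "v \<in> N"
  shows "coord u (val v) = (if u = v then 1 else 0)"
  using assms inj_value
  by (auto simp: coord_def representation_basis[OF independent_values] inj_on_eq_iff)

lemma finite_coord: "finite {u \<in> N. coord u a \<noteq> 0}"
proof (rule finite_imageD)
  show "finite (val ` {u \<in> N. coord u a \<noteq> 0})"
    by (rule finite_subset[OF _ finite_representation[of "val ` N" a]]) (auto simp: coord_def)
  show "inj_on val {u \<in> N. coord u a \<noteq> 0}"
    using inj_value by (rule inj_on_subset) auto
qed

lemma in_span_coord: "a \<in> span (val ` {u \<in> N. coord u a \<noteq> 0})"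
proof -
  let ?r = "representation (val ` N) a"
  have "(\<Sum>b | ?r b \<noteq> 0. scale (?r b) b) \<in> span (val ` {u \<in> N. coord u a \<noteq> 0})"
  proof (intro span_sum span_scale span_base)
    fix b assume "b \<in> {b. ?r b \<noteq> 0}"
    then show "b \<in> val ` {u \<in> N. coord u a \<noteq> 0}"
      using representation_ne_zero[of "val ` N" a b] by (auto simp: coord_def)
  qed
  then show ?thesis
    using sum_nonzero_representation_eq[OF independent_values, of a] by (simp add: span_values)
qed

lemma span_coord_iff:
  assumes "V \<subseteq> N"
  shows "a \<in> span (val ` V) \<longleftrightarrow> (\<forall>u\<in>N. coord u a \<noteq> 0 \<longrightarrow> u \<in> V)"
proof
  assume "a \<in> span (val ` V)"
  moreover have "span (val ` V) \<subseteq> {a. \<forall>u\<in>N - V. coord u a = 0}"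
  proof (rule span_minimal)
    show "val ` V \<subseteq> {a. \<forall>u\<in>N - V. coord u a = 0}"
      using assms by (auto simp: coord_val)
    show "subspace {a. \<forall>u\<in>N - V. coord u a = 0}"
      by (simp add: subspace_def)
  qed
  ultimately show "\<forall>u\<in>N. coord u a \<noteq> 0 \<longrightarrow> u \<in> V" by blast
next
  assume "\<forall>u\<in>N. coord u a \<noteq> 0 \<longrightarrow> u \<in> V"
  then have "span (val ` {u \<in> N. coord u a \<noteq> 0}) \<subseteq> span (val ` V)"
    by (intro span_mono) auto
  then show "a \<in> span (val ` V)" using in_span_coord by blast
qed

section \<open>Free modules on chains of bad pairs\<close>

text \<open>All spans of module elements below are taken over the field, in the space of all functions
  from labels to the algebra.\<close>

sublocale fs: vector_space "\<lambda>(c::'k) (f::nat \<Rightarrow> 'a) e. scale c (f e)"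
  by unfold_locales (auto simp: fun_eq_iff scale_right_distrib scale_left_distrib)

definition chains :: "nat \<Rightarrow> 'w list set" where
  "chains i = {c. set c \<subseteq> W \<and> length c = i \<and> successively (\<lambda>p q. \<not> good p q) c}"

text \<open>Chains are countably many, so they can be coded by the natural numbers that label the basis
  elements of a resolution.\<close>

definition chain_labels :: "nat \<Rightarrow> nat set" where
  "chain_labels i = to_nat ` chains i"

text \<open>The element \<open>e\<^sub>c u\<close> of the free module. With \<open>u\<close> normal, these form a basis over the field.\<close>

definition basis_elt :: "'w list \<Rightarrow> 'w list \<Rightarrow> nat \<Rightarrow> 'a" where
  "basis_elt c u = single (to_nat c) (val u)"

definition basis_span :: "nat \<Rightarrow> ('w list \<Rightarrow> 'w list \<Rightarrow> bool) \<Rightarrow> (nat \<Rightarrow> 'a) set" where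
  "basis_span i R = fs.span {basis_elt c u |c u. c \<in> chains i \<and> u \<in> N \<and> R c u}"

lemma subspace_basis_span: "fs.subspace (basis_span i R)"
  unfolding basis_span_def by (rule fs.subspace_span)

lemma basis_elt_in_span: "c \<in> chains i \<Longrightarrow> u \<in> N \<Longrightarrow> R c u \<Longrightarrow> basis_elt c u \<in> basis_span i R"
  unfolding basis_span_def by (rule fs.span_base) auto

lemma basis_span_minimal:
  assumes "fs.subspace S" "\<And>c u. c \<in> chains i \<Longrightarrow> u \<in> N \<Longrightarrow> R c u \<Longrightarrow> basis_elt c u \<in> S"
  shows "basis_span i R \<subseteq> S"
  unfolding basis_span_def using assms by (intro fs.span_minimal) auto

lemma basis_span_mono: "(\<And>c u. c \<in> chains i \<Longrightarrow> u \<in> N \<Longrightarrow> R c u \<Longrightarrow> R' c u) \<Longrightarrow> basis_span i R \<subseteq> basis_span i R'"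
  by (intro basis_span_minimal subspace_basis_span basis_elt_in_span)

lemma subspace_free_module: "fs.subspace (free_module Y)"
  unfolding fs.subspace_def
proof (intro conjI ballI allI)
  fix f g :: "nat \<Rightarrow> 'a" assume "f \<in> free_module Y" "g \<in> free_module Y"
  then have "finite {e. (f + g) e \<noteq> 0}" "{e. (f + g) e \<noteq> 0} \<subseteq> {e. f e \<noteq> 0} \<union> {e. g e \<noteq> 0}"
    and "{e. f e \<noteq> 0} \<union> {e. g e \<noteq> 0} \<subseteq> Y"
    using finite_supp_add[of f g] by (auto simp: free_module_def)
  then show "f + g \<in> free_module Y"
    unfolding free_module_def by blast
next
  fix c :: 'k and f :: "nat \<Rightarrow> 'a" assume f: "f \<in> free_module Y"
  have sub: "{e. scale c (f e) \<noteq> 0} \<subseteq> {e. f e \<noteq> 0}" by (rule Collect_mono) simp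
  show "(\<lambda>e. scale c (f e)) \<in> free_module Y"
    using f finite_subset[OF sub] sub unfolding free_module_def by blast
qed (simp add: free_module_def)

lemma single_scale: "single e (scale c a) = (\<lambda>e'. scale c (single e a e'))"
  by (auto simp: single_def)

lemma subspace_single:
  assumes "fs.subspace S"
  shows "subspace {a. single e a \<in> S}"
proof (rule subspaceI)
  have "single e 0 = (0::nat \<Rightarrow> 'a)"
    by (auto simp: single_def)
  then show "0 \<in> {a. single e a \<in> S}"
    using fs.subspace_0[OF assms] by simp
next
  fix a a' assume "a \<in> {a. single e a \<in> S}" "a' \<in> {a. single e a \<in> S}"
  then show "a + a' \<in> {a. single e a \<in> S}"
    using fs.subspace_add[OF assms] by (simp add: single_add)
next
  fix c a assume "a \<in> {a. single e a \<in> S}"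
  then show "scale c a \<in> {a. single e a \<in> S}"
    using fs.subspace_scale[OF assms, of "single e a" c] by (simp add: single_scale)
qed

lemma basis_elt_free: "c \<in> chains i \<Longrightarrow> basis_elt c u \<in> free_module (chain_labels i)"
  by (auto simp: basis_elt_def free_module_def supp_single chain_labels_def)

lemma coord_basis_elt:
  assumes "u \<in> N" "v \<in> N"
  shows "coord u (basis_elt c v (to_nat c')) = (if c' = c \<and> u = v then 1 else 0)"
  using assms by (simp add: basis_elt_def single_def coord_val)

text \<open>Membership in the span of a set of basis elements is a condition on the support, because the
  normal words are independent in each component.\<close>

lemma basis_span_iff:
  "f \<in> basis_span i R \<longleftrightarrow> f \<in> free_module (chain_labels i) \<and>
     (\<forall>c\<in>chains i. \<forall>u\<in>N. coord u (f (to_nat c)) \<noteq> 0 \<longrightarrow> R c u)"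
proof
  assume "f \<in> basis_span i R"
  moreover have "basis_span i R \<subseteq> {f \<in> free_module (chain_labels i).
      \<forall>c\<in>chains i. \<forall>u\<in>N. coord u (f (to_nat c)) \<noteq> 0 \<longrightarrow> R c u}"
  proof (rule basis_span_minimal)
    show "fs.subspace {f \<in> free_module (chain_labels i).
        \<forall>c\<in>chains i. \<forall>u\<in>N. coord u (f (to_nat c)) \<noteq> 0 \<longrightarrow> R c u}" (is "fs.subspace ?S")
    proof (rule fs.subspaceI)
      show "0 \<in> ?S"
        using fs.subspace_0[OF subspace_free_module, of "chain_labels i"] by simp
    next
      fix f g assume fg: "f \<in> ?S" "g \<in> ?S"
      then have "f + g \<in> free_module (chain_labels i)"
        using fs.subspace_add[OF subspace_free_module] by blast
      moreover have "R c u" if "c \<in> chains i" "u \<in> N" "coord u ((f + g) (to_nat c)) \<noteq> 0" for c u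
      proof -
        have "coord u (f (to_nat c)) \<noteq> 0 \<or> coord u (g (to_nat c)) \<noteq> 0"
          using that(3) by (metis add_0 coord_add plus_fun_def)
        then show ?thesis using fg that by blast
      qed
      ultimately show "f + g \<in> ?S" by blast
    next
      fix c f assume f: "f \<in> ?S"
      then have "(\<lambda>e. scale c (f e)) \<in> free_module (chain_labels i)"
        using fs.subspace_scale[OF subspace_free_module] by blast
      moreover have "coord u (f e) \<noteq> 0" if "coord u (scale c (f e)) \<noteq> 0" for u e
        using that by simp
      ultimately show "(\<lambda>e. scale c (f e)) \<in> ?S" using f by blast
    qed
  qed (auto simp: coord_basis_elt basis_elt_free)
  ultimately show "f \<in> free_module (chain_labels i) \<and>
     (\<forall>c\<in>chains i. \<forall>u\<in>N. coord u (f (to_nat c)) \<noteq> 0 \<longrightarrow> R c u)" by blast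
next
  assume f: "f \<in> free_module (chain_labels i) \<and>
     (\<forall>c\<in>chains i. \<forall>u\<in>N. coord u (f (to_nat c)) \<noteq> 0 \<longrightarrow> R c u)"
  have single: "single e (f e) \<in> basis_span i R" if e: "e \<in> chain_labels i" for e
  proof -
    obtain c where c: "c \<in> chains i" "e = to_nat c" using e by (auto simp: chain_labels_def)
    have "span (val ` {u \<in> N. coord u (f e) \<noteq> 0}) \<subseteq> {a. single e a \<in> basis_span i R}"
      using c f by (intro span_minimal subspace_single subspace_basis_span)
        (auto intro!: basis_elt_in_span[unfolded basis_elt_def])
    then show ?thesis using in_span_coord by blast
  qed
  \<comment> \<open>Decompose \<open>f\<close> along the labels; each component then lies in the span by linearity.\<close>
  have f_eq: "f = (\<Sum>e | f e \<noteq> 0. single e (f e))"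
  proof
    fix e'
    have "(\<Sum>e | f e \<noteq> 0. single e (f e) e') = (\<Sum>e | f e \<noteq> 0. if e = e' then f e' else 0)"
      by (intro sum.cong) (auto simp: single_def)
    also have "\<dots> = f e'"
      using f by (simp add: free_module_def)
    also have "(\<Sum>e | f e \<noteq> 0. single e (f e) e') = (\<Sum>e | f e \<noteq> 0. single e (f e)) e'"
    proof -
      have "(\<Sum>e\<in>S. single e (f e)) e' = (\<Sum>e\<in>S. single e (f e) e')" for S
        by (induction S rule: infinite_finite_induct) (auto)
      then show ?thesis by simp
    qed
    finally show "f e' = (\<Sum>e | f e \<noteq> 0. single e (f e)) e'" by simp
  qed
  have "(\<Sum>e | f e \<noteq> 0. single e (f e)) \<in> basis_span i R"
    unfolding basis_span_def using f by (intro fs.span_sum single[unfolded basis_span_def]) (auto simp: free_module_def)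
  then show "f \<in> basis_span i R" by (rule forw_subst[OF f_eq])
qed

lemma basis_span_free: "f \<in> basis_span i R \<Longrightarrow> f \<in> free_module (chain_labels i)"
  using basis_span_iff by blast

lemma basis_span_True: "basis_span i (\<lambda>_ _. True) = free_module (chain_labels i)"
  using basis_span_iff by blast

section \<open>Leading terms\<close>

abbreviation word_span :: "nat \<Rightarrow> ('w list \<Rightarrow> bool) \<Rightarrow> (nat \<Rightarrow> 'a) set" where
  "word_span i P \<equiv> basis_span i (\<lambda>c u. P (c @ u))"

definition down_closed :: "('w list \<Rightarrow> bool) \<Rightarrow> bool" where
  "down_closed P \<longleftrightarrow> (\<forall>v w. v \<prec> w \<longrightarrow> P w \<longrightarrow> P v)"

lemma down_closed_below: "down_closed (\<lambda>v. v \<prec> w)"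
  using lt_trans by (auto simp: down_closed_def)

text \<open>Spanned by the basis elements that are not leading terms of boundaries.\<close>

definition reduced :: "nat \<Rightarrow> (nat \<Rightarrow> 'a) set" where
  "reduced i = basis_span i (\<lambda>c u. u = [] \<or> c @ [hd u] \<notin> chains (Suc i))"

lemma subspace_reduced: "fs.subspace (reduced i)"
  unfolding reduced_def by (rule subspace_basis_span)

text \<open>The triangular shape \<open>e\<^bsub>cp\<^esub> \<mapsto> p e\<^sub>c + lower terms\<close> of Anick's differential, from which
  exactness will be read off.\<close>

definition leading :: "nat \<Rightarrow> (nat \<Rightarrow> nat \<Rightarrow> 'a) \<Rightarrow> bool" where
  "leading i D \<longleftrightarrow>
     (\<forall>c\<in>chains (Suc i). D (to_nat c) - basis_elt (butlast c) [last c] \<in> word_span i (\<lambda>v. v \<prec> c))"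

lemma chains_set: "c \<in> chains i \<Longrightarrow> set c \<subseteq> W"
  by (simp add: chains_def)

lemma normal_set: "u \<in> N \<Longrightarrow> set u \<subseteq> W"
  by (simp add: normal_words_def)

lemma chains_length: "c \<in> chains i \<Longrightarrow> length c = i"
  by (simp add: chains_def)

lemma chains_0: "chains 0 = {[]}"
  by (auto simp: chains_def)

lemma chains_snoc:
  "c @ [p] \<in> chains (Suc i) \<longleftrightarrow> c \<in> chains i \<and> p \<in> W \<and> (c = [] \<or> \<not> good (last c) p)"
  by (auto simp: chains_def successively_append_iff)

lemma chainsE:
  assumes "c \<in> chains (Suc i)"
  obtains c' p where "c = c' @ [p]" "c' \<in> chains i" "p \<in> W"
  using assms by (cases c rule: rev_cases) (auto simp: chains_snoc chains_length dest: chains_length)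

lemma single_in_word_span:
  assumes c: "c \<in> chains i" and w: "set w \<subseteq> W" and P: "down_closed P" "P (c @ w)"
  shows "single (to_nat c) (val w) \<in> word_span i P"
proof -
  have "span (val ` {u \<in> N. u = w \<or> u \<prec> w}) \<subseteq> {a. single (to_nat c) a \<in> word_span i P}"
  proof (rule span_minimal[OF _ subspace_single[OF subspace_basis_span]], rule image_subsetI)
    fix u assume u: "u \<in> {u \<in> N. u = w \<or> u \<prec> w}"
    then have "P (c @ u)"
      using P lt_append_left[of u w c] unfolding down_closed_def by blast
    then show "val u \<in> {a. single (to_nat c) a \<in> word_span i P}"
      using u c basis_elt_in_span[of c i u "\<lambda>c u. P (c @ u)"] by (simp add: basis_elt_def)
  qed
  then show ?thesis using value_in_span[OF w] by blast
qed

text \<open>Rewriting a word that is not normal produces strictly lower words only.\<close>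

lemma single_non_normal_in_word_span:
  assumes c: "c \<in> chains i" and w: "set w \<subseteq> W" "w \<notin> N"
  shows "single (to_nat c) (val w) \<in> word_span i (\<lambda>v. v \<prec> c @ w)"
proof -
  have "span (val ` {u \<in> N. u \<prec> w}) \<subseteq> {a. single (to_nat c) a \<in> word_span i (\<lambda>v. v \<prec> c @ w)}"
  proof (rule span_minimal[OF _ subspace_single[OF subspace_basis_span]], rule image_subsetI)
    fix u assume u: "u \<in> {u \<in> N. u \<prec> w}"
    then have "c @ u \<prec> c @ w" using lt_append_left by blast
    then show "val u \<in> {a. single (to_nat c) a \<in> word_span i (\<lambda>v. v \<prec> c @ w)}"
      using u c basis_elt_in_span[of c i u "\<lambda>c' u. c' @ u \<prec> c @ w"] by (simp add: basis_elt_def)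
  qed
  then show ?thesis using value_non_normal[OF w] by blast
qed

lemma subspace_fs_mult:
  assumes "fs.subspace S"
  shows "fs.subspace {f. (\<lambda>e. a * f e) \<in> S}"
proof (rule fs.subspaceI)
  show "0 \<in> {f. (\<lambda>e. a * f e) \<in> S}"
    using fs.subspace_0[OF assms] by (simp add: zero_fun_def)
next
  fix f g assume "f \<in> {f. (\<lambda>e. a * f e) \<in> S}" "g \<in> {f. (\<lambda>e. a * f e) \<in> S}"
  then have "(\<lambda>e. a * f e) + (\<lambda>e. a * g e) \<in> S"
    using fs.subspace_add[OF assms] by blast
  then show "f + g \<in> {f. (\<lambda>e. a * f e) \<in> S}"
    by (simp add: plus_fun_def distrib_left)
next
  fix c f assume "f \<in> {f. (\<lambda>e. a * f e) \<in> S}"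
  then have "(\<lambda>e. scale c (a * f e)) \<in> S"
    using fs.subspace_scale[OF assms, of "\<lambda>e. a * f e" c] by simp
  then show "(\<lambda>e. scale c (f e)) \<in> {f. (\<lambda>e. a * f e) \<in> S}"
    by (simp add: mult_scale)
qed

lemma mult_in_word_span:
  assumes f: "f \<in> word_span i (\<lambda>v. v \<prec> w)" and u: "set u \<subseteq> W"
  shows "(\<lambda>e. val u * f e) \<in> word_span i (\<lambda>v. v \<prec> w @ u)"
proof -
  have "word_span i (\<lambda>v. v \<prec> w) \<subseteq> {f. (\<lambda>e. val u * f e) \<in> word_span i (\<lambda>v. v \<prec> w @ u)}"
  proof (rule basis_span_minimal[OF subspace_fs_mult[OF subspace_basis_span]])
    fix c u' assume c: "c \<in> chains i" and u': "u' \<in> N" and lt: "c @ u' \<prec> w"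
    have "single (to_nat c) (val (u' @ u)) \<in> word_span i (\<lambda>v. v \<prec> w @ u)"
      by (rule single_in_word_span[OF c _ down_closed_below])
        (use u u' lt_append_right[OF lt, of u] in \<open>auto dest: normal_set\<close>)
    moreover have "(\<lambda>e. val u * basis_elt c u' e) = single (to_nat c) (val (u' @ u))"
      by (auto simp: basis_elt_def single_def mult.commute)
    ultimately show "basis_elt c u' \<in> {f. (\<lambda>e. val u * f e) \<in> word_span i (\<lambda>v. v \<prec> w @ u)}"
      by simp
  qed
  then show ?thesis using f by blast
qed

lemma free_finite: "f \<in> free_module Y \<Longrightarrow> finite {e. f e \<noteq> 0}"
  by (simp add: free_module_def)

lemma lin_ext_scale:
  assumes "f \<in> free_module Y"
  shows "lin_ext D (\<lambda>e. scale c (f e)) = (\<lambda>e. scale c (lin_ext D f e))"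
proof -
  have "lin_ext D (\<lambda>e. scale c 1 * f e) = (\<lambda>e. scale c 1 * lin_ext D f e)"
    by (rule lin_ext_mult[OF free_finite[OF assms]])
  then show ?thesis by (simp flip: scale_as_mult)
qed

lemma lin_ext_add_free:
  assumes "f \<in> free_module Y" "g \<in> free_module Y"
  shows "lin_ext D (f + g) = lin_ext D f + lin_ext D g"
  using assms by (intro lin_ext_add) (auto simp: free_module_def)

lemma subspace_coord_lin_ext:
  "fs.subspace {y \<in> free_module Y. coord u (lin_ext D y e) = k * coord v (y e')}"
  (is "fs.subspace ?S")
proof (rule fs.subspaceI)
  show "0 \<in> ?S" using fs.subspace_0[OF subspace_free_module] by (simp add: lin_ext_zero)
next
  fix f g assume fg: "f \<in> ?S" "g \<in> ?S"
  then have "f + g \<in> free_module Y"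
    using fs.subspace_add[OF subspace_free_module] by blast
  then show "f + g \<in> ?S"
    using fg by (simp add: lin_ext_add_free[of f Y g] distrib_left)
next
  fix c f assume f: "f \<in> ?S"
  then have "(\<lambda>e. scale c (f e)) \<in> free_module Y"
    using fs.subspace_scale[OF subspace_free_module] by blast
  then show "(\<lambda>e. scale c (f e)) \<in> ?S"
    using f by (simp add: lin_ext_scale[of f Y])
qed

lemma lin_ext_diff:
  fixes f g :: "nat \<Rightarrow> 'a"
  assumes "f \<in> free_module Y" "g \<in> free_module Y"
  shows "lin_ext D (f - g) = lin_ext D f - lin_ext D g"
proof -
  have "f - g \<in> free_module Y"
    by (rule fs.subspace_diff[OF subspace_free_module assms])
  then have "lin_ext D (f - g + g) = lin_ext D (f - g) + lin_ext D g"
    using assms by (intro lin_ext_add free_finite)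
  then show ?thesis by simp
qed

text \<open>Multiplying the leading term of \<open>e\<^bsub>cp\<^esub>\<close> by \<open>u\<close> gives \<open>(pu) e\<^sub>c\<close>, and the lower terms stay lower.
  The word \<open>pu\<close> may fail to be normal, so its value is left as it is.\<close>

lemma lin_ext_basis_elt:
  assumes D: "leading i D" and c: "c @ [p] \<in> chains (Suc i)" and u: "set u \<subseteq> W"
  shows "lin_ext D (basis_elt (c @ [p]) u) - single (to_nat c) (val (p # u))
    \<in> word_span i (\<lambda>v. v \<prec> c @ p # u)"
proof -
  have "D (to_nat (c @ [p])) - basis_elt c [p] \<in> word_span i (\<lambda>v. v \<prec> c @ [p])"
    using D c unfolding leading_def by fastforce
  from mult_in_word_span[OF this u]
  have "(\<lambda>e. val u * (D (to_nat (c @ [p])) - basis_elt c [p]) e) \<in> word_span i (\<lambda>v. v \<prec> c @ p # u)"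
    by simp
  moreover have "(\<lambda>e. val u * (D (to_nat (c @ [p])) - basis_elt c [p]) e) =
      lin_ext D (basis_elt (c @ [p]) u) - single (to_nat c) (val (p # u))"
  proof
    fix e
    show "val u * (D (to_nat (c @ [p])) - basis_elt c [p]) e =
      (lin_ext D (basis_elt (c @ [p]) u) - single (to_nat c) (val (p # u))) e"
      by (simp add: basis_elt_def lin_ext_single right_diff_distrib) (simp add: single_def mult.commute)
  qed
  ultimately show ?thesis by simp
qed

text \<open>Non-reduced basis elements are leading terms of boundaries, so subtracting boundaries removes
  them from the top downwards. The bound \<open>P\<close> on the words is kept, because the construction of the next
  differential needs to know that the subtracted boundary comes from low words.\<close>

lemma reduce:
  assumes D: "leading i D" and P: "down_closed P" and z: "z \<in> word_span i P"
  obtains y where "y \<in> word_span (Suc i) P" "z - lin_ext D y \<in> reduced i"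
proof -
  let ?S = "{z. \<exists>y\<in>word_span (Suc i) P. z - lin_ext D y \<in> reduced i}"
  have subspace: "fs.subspace ?S"
  proof (rule fs.subspaceI)
    show "0 \<in> ?S"
      using fs.subspace_0[OF subspace_basis_span] lin_ext_zero[of D] by (auto simp: reduced_def intro!: bexI[of _ 0])
  next
    fix f g assume "f \<in> ?S" "g \<in> ?S"
    then obtain y z where yz: "y \<in> word_span (Suc i) P" "f - lin_ext D y \<in> reduced i"
      "z \<in> word_span (Suc i) P" "g - lin_ext D z \<in> reduced i" by blast
    have "lin_ext D (y + z) = lin_ext D y + lin_ext D z"
      by (rule lin_ext_add_free[OF basis_span_free[OF yz(1)] basis_span_free[OF yz(3)]])
    then have eq: "f + g - lin_ext D (y + z) = (f - lin_ext D y) + (g - lin_ext D z)"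
      by simp
    have "f + g - lin_ext D (y + z) \<in> reduced i"
      unfolding eq by (rule fs.subspace_add[OF subspace_reduced yz(2,4)])
    moreover have "y + z \<in> word_span (Suc i) P"
      using fs.subspace_add[OF subspace_basis_span] yz by blast
    ultimately show "f + g \<in> ?S" by blast
  next
    fix c f assume "f \<in> ?S"
    then obtain y where y: "y \<in> word_span (Suc i) P" "f - lin_ext D y \<in> reduced i" by blast
    have "(\<lambda>e. scale c (f e)) - lin_ext D (\<lambda>e. scale c (y e)) = (\<lambda>e. scale c ((f - lin_ext D y) e))"
      by (simp add: lin_ext_scale[OF basis_span_free[OF y(1)]] fun_eq_iff scale_right_diff_distrib)
    then have "(\<lambda>e. scale c (f e)) - lin_ext D (\<lambda>e. scale c (y e)) \<in> reduced i"
      using fs.subspace_scale[OF subspace_basis_span y(2)[unfolded reduced_def], of c]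
      unfolding reduced_def by simp
    moreover have "(\<lambda>e. scale c (y e)) \<in> word_span (Suc i) P"
      using fs.subspace_scale[OF subspace_basis_span y(1)] .
    ultimately show "(\<lambda>e. scale c (f e)) \<in> ?S" by blast
  qed
  have basis_elt: "basis_elt c u \<in> ?S" if "c \<in> chains i" "u \<in> N" "P (c @ u)" for c u
    using that
  proof (induction "rank (c @ u)" arbitrary: c u rule: less_induct)
    case less
    show ?case
    proof (cases "u = [] \<or> c @ [hd u] \<notin> chains (Suc i)")
      case True
      then have "basis_elt c u - lin_ext D 0 \<in> reduced i"
        unfolding reduced_def using less.prems by (simp add: lin_ext_zero basis_elt_in_span)
      then show ?thesis using fs.subspace_0[OF subspace_basis_span] by blast
    next
      case False
      then obtain p u' where u: "u = p # u'" and c': "c @ [p] \<in> chains (Suc i)"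
        by (cases u) auto
      have u': "u' \<in> N"
        using less.prems(2) u by (simp add: normal_words_def successively_Cons) auto
      let ?y = "basis_elt (c @ [p]) u'"
      have y: "?y \<in> word_span (Suc i) P"
        using c' u' less.prems u by (intro basis_elt_in_span) auto
      have "lin_ext D ?y - basis_elt c u \<in> word_span i (\<lambda>v. v \<prec> c @ u)"
        using lin_ext_basis_elt[OF D c' normal_set[OF u']] u by (simp add: basis_elt_def)
      moreover have "word_span i (\<lambda>v. v \<prec> c @ u) \<subseteq> ?S"
      proof (rule basis_span_minimal[OF subspace])
        fix c2 u2 assume c2: "c2 \<in> chains i" "u2 \<in> N" "c2 @ u2 \<prec> c @ u"
        then have "rank (c2 @ u2) < rank (c @ u)"
          by (intro rank_less) (auto dest: chains_set normal_set)
        moreover have "P (c2 @ u2)"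
          using P c2(3) less.prems(3) unfolding down_closed_def by blast
        ultimately show "basis_elt c2 u2 \<in> ?S" using less.hyps c2 by blast
      qed
      ultimately have low: "lin_ext D ?y - basis_elt c u \<in> ?S" by blast
      have "lin_ext D ?y \<in> ?S"
        using y fs.subspace_0[OF subspace_reduced] by (auto intro!: bexI[of _ ?y])
      from fs.subspace_diff[OF subspace this low] show ?thesis
        by (simp only: diff_diff_eq2 add_diff_cancel_left')
    qed
  qed
  have "word_span i P \<subseteq> ?S"
    using basis_elt by (intro basis_span_minimal[OF subspace])
  then show ?thesis using z that by blast
qed

text \<open>For reduced \<open>e\<^bsub>cq\<^esub> u\<close> the word \<open>qu\<close> is normal, so the boundary has leading term \<open>e\<^sub>c (qu)\<close>, and
  distinct reduced elements have distinct leading terms. A maximal word in the support of \<open>t\<close>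
  therefore survives in its boundary.\<close>

lemma reduced_kernel:
  assumes D: "leading i D" and t: "t \<in> reduced (Suc i)" and zero: "lin_ext D t = 0"
  shows "t = 0"
proof (rule ccontr)
  assume "t \<noteq> 0"
  define K where "K = {(c, u). c \<in> chains (Suc i) \<and> u \<in> N \<and> coord u (t (to_nat c)) \<noteq> 0}"
  have t_free: "t \<in> free_module (chain_labels (Suc i))"
    using t unfolding reduced_def by (rule basis_span_free)
  have "K \<noteq> {}"
  proof
    assume "K = {}"
    then have "t \<in> basis_span (Suc i) (\<lambda>_ _. False)"
      using t_free unfolding basis_span_iff K_def by blast
    then have "t = 0" unfolding basis_span_def by simp
    then show False using \<open>t \<noteq> 0\<close> by simp
  qed
  have "finite (chains (Suc i))"
    unfolding chains_def by (rule finite_subset[OF _ finite_lists_length_eq[OF finite_letters]]) auto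
  then have "finite (SIGMA c:chains (Suc i). {u \<in> N. coord u (t (to_nat c)) \<noteq> 0})"
    using finite_coord by blast
  then have "finite K" by (rule finite_subset[rotated]) (auto simp: K_def)
  define m where "m = Max ((\<lambda>(c, u). rank (c @ u)) ` K)"
  have "m \<in> (\<lambda>(c, u). rank (c @ u)) ` K"
    unfolding m_def using \<open>finite K\<close> \<open>K \<noteq> {}\<close> by (intro Max_in) auto
  then obtain c0 u0 where K0: "(c0, u0) \<in> K" and m: "m = rank (c0 @ u0)"
    by auto
  have max: "\<not> c0 @ u0 \<prec> c @ u" if "(c, u) \<in> K" for c u
  proof
    assume "c0 @ u0 \<prec> c @ u"
    moreover have "set (c0 @ u0) \<subseteq> W"
      using K0 by (auto simp: K_def dest: chains_set normal_set)
    ultimately have "m < rank (c @ u)"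
      unfolding m using rank_less by blast
    moreover have "rank (c @ u) \<le> m"
      unfolding m_def using \<open>finite K\<close> that by (intro Max_ge) force+
    ultimately show False by simp
  qed
  obtain c' q where c0: "c0 = c' @ [q]" and c': "c' \<in> chains i"
    using K0 chainsE[of c0 i] unfolding K_def by blast
  \<comment> \<open>The terms of \<open>t\<close> are reduced and not above the maximal word; on such terms the coordinate
    at the leading term of \<open>(c0, u0)\<close> sees only \<open>(c0, u0)\<close>.\<close>
  let ?R = "\<lambda>c u. (u = [] \<or> c @ [hd u] \<notin> chains (Suc (Suc i))) \<and> \<not> c0 @ u0 \<prec> c @ u"
  have u0: "u0 \<in> N" "c0 \<in> chains (Suc i)" using K0 by (auto simp: K_def)
  have normal: "last c # u \<in> N"
    if "c \<in> chains (Suc i)" "u \<in> N" "u = [] \<or> c @ [hd u] \<notin> chains (Suc (Suc i))" for c u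
  proof -
    obtain c1 p where c1: "c = c1 @ [p]" "p \<in> W"
      using chainsE[OF \<open>c \<in> chains (Suc i)\<close>] by metis
    have "good p (hd u)" if u: "u \<noteq> []"
    proof -
      have "hd u \<in> W" using normal_set[OF \<open>u \<in> N\<close>] u by auto
      moreover have "c @ [hd u] \<notin> chains (Suc (Suc i))" using u \<open>u = [] \<or> _\<close> by simp
      ultimately show ?thesis
        using \<open>c \<in> chains (Suc i)\<close> c1 unfolding chains_snoc by simp
    qed
    then show ?thesis using c1 \<open>u \<in> N\<close> by (auto simp: normal_words_def successively_Cons)
  qed
  have tR: "t \<in> basis_span (Suc i) ?R"
    using t max unfolding reduced_def basis_span_iff K_def by blast
  let ?S = "{y \<in> free_module (chain_labels (Suc i)).
      coord (q # u0) (lin_ext D y (to_nat c')) = coord u0 (y (to_nat c0))}"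
  have "basis_span (Suc i) ?R \<subseteq> ?S"
  proof (rule basis_span_minimal)
    show "fs.subspace ?S"
      using subspace_coord_lin_ext[of _ _ _ _ 1] by simp
  next
    fix c u assume c: "c \<in> chains (Suc i)" and u: "u \<in> N" and R: "?R c u"
    obtain c1 p where c1: "c = c1 @ [p]" "c1 \<in> chains i" using chainsE[OF c] by metis
    let ?low = "lin_ext D (basis_elt c u) - single (to_nat c1) (val (p # u))"
    have low: "?low \<in> word_span i (\<lambda>v. v \<prec> c @ u)"
      using lin_ext_basis_elt[OF D c[unfolded c1] normal_set[OF u]] c1 by simp
    have n: "p # u \<in> N" "q # u0 \<in> N"
      using normal[OF c u] R c1 normal[OF u0(2,1)] t K0 c0
      unfolding reduced_def basis_span_iff K_def by auto
    have "coord (q # u0) (?low (to_nat c')) = 0"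
      using low c' n R c0 unfolding basis_span_iff by fastforce
    then have "coord (q # u0) (lin_ext D (basis_elt c u) (to_nat c')) =
        coord (q # u0) (basis_elt c1 (p # u) (to_nat c'))"
      by (simp add: basis_elt_def)
    also have "\<dots> = coord u0 (basis_elt c u (to_nat c0))"
      unfolding coord_basis_elt[OF n(2,1)] coord_basis_elt[OF u0(1) u] using c0 c1 by auto
    finally show "basis_elt c u \<in> ?S" using basis_elt_free[OF c] by simp
  qed
  then have "coord (q # u0) (lin_ext D t (to_nat c')) = coord u0 (t (to_nat c0))"
    using tR by blast
  then show False using zero K0 by (simp add: K_def)
qed

text \<open>For a chain \<open>cqp\<close> the pair \<open>qp\<close> is bad, so the boundary of \<open>p e\<^bsub>cq\<^esub>\<close> consists of words strictly
  below \<open>cqp\<close>. By reduction it is the boundary of some \<open>y\<close> made of such words, and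
  \<open>p e\<^bsub>cq\<^esub> - y\<close> is a cycle with the required leading term. The hypothesis \<open>inj\<close> says that no nonzero
  boundary is reduced; it makes the remainder of the reduction vanish.\<close>

lemma extend_differential:
  assumes D: "leading i D"
    and inj: "\<And>y. y \<in> free_module (chain_labels (Suc i)) \<Longrightarrow> lin_ext D y \<in> reduced i \<Longrightarrow> lin_ext D y = 0"
  shows "\<exists>D'. leading (Suc i) D' \<and> (\<forall>e\<in>chain_labels (Suc (Suc i)). lin_ext D (D' e) = 0)"
proof -
  have "\<exists>z. lin_ext D z = 0 \<and> z - basis_elt (butlast c) [last c] \<in> word_span (Suc i) (\<lambda>v. v \<prec> c)"
    if c: "c \<in> chains (Suc (Suc i))" for c
  proof -
    obtain c1 p where c1: "c = c1 @ [p]" "c1 \<in> chains (Suc i)" "p \<in> W" using chainsE[OF c] by metis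
    obtain c2 q where c2: "c1 = c2 @ [q]" "c2 \<in> chains i" "q \<in> W" using chainsE[OF c1(2)] by metis
    have bad: "\<not> good q p" using c unfolding c1(1) chains_snoc c2(1) by simp
    let ?low = "lin_ext D (basis_elt c1 [p]) - single (to_nat c2) (val [q, p])"
    have "?low \<in> word_span i (\<lambda>v. v \<prec> c)"
      using lin_ext_basis_elt[OF D c1(2)[unfolded c2], of "[p]"] c1 c2 by simp
    moreover have "single (to_nat c2) (val [q, p]) \<in> word_span i (\<lambda>v. v \<prec> c)"
      using single_non_normal_in_word_span[OF c2(2), of "[q, p]"] c1 c2 bad by (simp add: normal_words_def)
    ultimately have "?low + single (to_nat c2) (val [q, p]) \<in> word_span i (\<lambda>v. v \<prec> c)"
      by (rule fs.subspace_add[OF subspace_basis_span])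
    then have v: "lin_ext D (basis_elt c1 [p]) \<in> word_span i (\<lambda>v. v \<prec> c)" by simp
    obtain y where y: "y \<in> word_span (Suc i) (\<lambda>v. v \<prec> c)"
        "lin_ext D (basis_elt c1 [p]) - lin_ext D y \<in> reduced i"
      using reduce[OF D down_closed_below v] .
    have free: "basis_elt c1 [p] \<in> free_module (chain_labels (Suc i))" "y \<in> free_module (chain_labels (Suc i))"
      using basis_elt_free[OF c1(2)] basis_span_free[OF y(1)] by auto
    have "lin_ext D (basis_elt c1 [p] - y) = 0"
      using y(2) by (intro inj fs.subspace_diff[OF subspace_free_module] free)
        (simp add: lin_ext_diff[OF free])
    moreover have "basis_elt c1 [p] - y - basis_elt c1 [p] \<in> word_span (Suc i) (\<lambda>v. v \<prec> c)"
      using fs.subspace_neg[OF subspace_basis_span y(1)] by simp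
    ultimately show ?thesis using c1 by auto
  qed
  then obtain Z where Z: "\<And>c. c \<in> chains (Suc (Suc i)) \<Longrightarrow>
      lin_ext D (Z c) = 0 \<and> Z c - basis_elt (butlast c) [last c] \<in> word_span (Suc i) (\<lambda>v. v \<prec> c)"
    by metis
  then show ?thesis
    by (intro exI[of _ "\<lambda>e. Z (from_nat e)"]) (auto simp: leading_def chain_labels_def)
qed

section \<open>Generation and augmentation\<close>

lemma component_0: "A 0 = range (\<lambda>c. scale c 1)"
proof -
  have "{u \<in> N. length u = 0} = {[]}" by auto
  then show ?thesis by (simp add: component_eq span_singleton)
qed

lemma generated: "finitely_generated_deg1 scale A"
proof -
  have "x ` W \<subseteq> A 1"
  proof
    fix y assume "y \<in> x ` W"
    then obtain p where "p \<in> W" "y = x p" by auto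
    then have "[p] \<in> {u \<in> N. length u = 1}" "y = val [p]" by (auto simp: normal_words_def)
    then show "y \<in> A 1" unfolding component_eq by (metis imageI span_base)
  qed
  moreover have "val ` N \<subseteq> {\<Prod>y\<in>#M. y |M. set_mset M \<subseteq> x ` W}"
  proof
    fix y assume "y \<in> val ` N"
    then obtain u where u: "u \<in> N" "y = val u" by auto
    then have "y = (\<Prod>y\<in>#mset (map x u). y)" "set_mset (mset (map x u)) \<subseteq> x ` W"
      using normal_set[of u] by (auto simp: word_value_def prod_mset_prod_list simp flip: mset_map)
    then show "y \<in> {\<Prod>y\<in>#M. y |M. set_mset M \<subseteq> x ` W}" by blast
  qed
  then have "span {\<Prod>y\<in>#M. y |M. set_mset M \<subseteq> x ` W} = UNIV"
    using span_mono span_values by blast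
  ultimately show ?thesis
    unfolding finitely_generated_deg1_def using finite_letters by blast
qed

lemma irrelevant_ideal_eq: "irrelevant_ideal scale A = span (val ` {u \<in> N. u \<noteq> []})"
proof -
  have "val u \<in> (\<Union>n\<in>{1..}. A n)" if "u \<in> N" "u \<noteq> []" for u
  proof
    show "length u \<in> {1..}" using that by (cases u) auto
    show "val u \<in> A (length u)" unfolding component_eq using that by (intro span_base imageI) simp
  qed
  then have "span (val ` {u \<in> N. u \<noteq> []}) \<subseteq> irrelevant_ideal scale A"
    unfolding irrelevant_ideal_def by (intro span_mono) auto
  moreover have "A n \<subseteq> span (val ` {u \<in> N. u \<noteq> []})" if "n \<in> {1..}" for n
    unfolding component_eq using that by (intro span_mono) auto
  then have "irrelevant_ideal scale A \<subseteq> span (val ` {u \<in> N. u \<noteq> []})"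
    unfolding irrelevant_ideal_def by (intro span_minimal) auto
  ultimately show ?thesis by blast
qed

text \<open>The irrelevant ideal is spanned by the nonempty normal words, so it is the kernel of the
  coordinate at the empty word.\<close>

lemma augmentation_eq: "augmentation scale A = coord []"
proof
  fix a
  have "coord u 1 = (if u = [] then 1 else 0)" if "u \<in> N" for u
    using coord_val[OF that normal_Nil] by simp
  then have "a - scale c 1 \<in> irrelevant_ideal scale A \<longleftrightarrow> c = coord [] a" for c
    unfolding irrelevant_ideal_eq by (subst span_coord_iff) auto
  then show "augmentation scale A a = coord [] a"
    unfolding augmentation_def by simp
qed

text \<open>The order on words respects length, so the lower terms of \<open>e\<^bsub>cp\<^esub>\<close> are \<open>e\<^bsub>c'\<^esub> q\<close> with a single letter
  \<open>q\<close>. This is where linearity of the resolution comes from.\<close>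

lemma leading_degree:
  assumes D: "leading i D" and e: "e \<in> chain_labels (Suc i)"
  shows "D e \<in> free_component A (chain_labels i) (\<lambda>_. i) (Suc i)"
proof -
  obtain c where c: "c \<in> chains (Suc i)" "e = to_nat c" using e by (auto simp: chain_labels_def)
  obtain c' p where c': "c = c' @ [p]" "c' \<in> chains i" "p \<in> W" using chainsE[OF c(1)] by metis
  have p: "[p] \<in> N" using c' by (simp add: normal_words_def)
  let ?R = "\<lambda>(_::'w list) u. length u = 1"
  have "D e - basis_elt c' [p] \<in> word_span i (\<lambda>v. v \<prec> c)"
    using D c c' unfolding leading_def by fastforce
  moreover have "word_span i (\<lambda>v. v \<prec> c) \<subseteq> basis_span i ?R"
  proof (rule basis_span_mono)
    fix d u assume "d \<in> chains i" "d @ u \<prec> c"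
    then show "length u = 1"
      using lt_length[of "d @ u" c] chains_length[OF c(1)] chains_length[of d i] by simp
  qed
  moreover have "basis_elt c' [p] \<in> basis_span i ?R" using c' p by (intro basis_elt_in_span) auto
  ultimately have "D e - basis_elt c' [p] + basis_elt c' [p] \<in> basis_span i ?R"
    by (intro fs.subspace_add[OF subspace_basis_span]) auto
  then have De: "D e \<in> basis_span i ?R" by simp
  have "D e e' \<in> A 1" if "D e e' \<noteq> 0" for e'
  proof -
    have "e' \<in> chain_labels i" using basis_span_free[OF De] that by (auto simp: free_module_def)
    then obtain d where "d \<in> chains i" "e' = to_nat d" by (auto simp: chain_labels_def)
    then have "\<forall>u\<in>N. coord u (D e e') \<noteq> 0 \<longrightarrow> u \<in> {u \<in> N. length u = 1}"
      using De unfolding basis_span_iff by blast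
    then show ?thesis unfolding component_eq by (subst span_coord_iff) auto
  qed
  then show ?thesis using basis_span_free[OF De] by (auto simp: free_component_def)
qed

lemma lin_ext_free:
  assumes D: "leading i D" and y: "y \<in> free_module (chain_labels (Suc i))"
  shows "lin_ext D y \<in> free_module (chain_labels i)"
proof -
  have De: "D e \<in> free_module (chain_labels i)" if "y e \<noteq> 0" for e
    using leading_degree[OF D, of e] y that by (auto simp: free_component_def free_module_def)
  have "{e'. lin_ext D y e' \<noteq> 0} \<subseteq> (\<Union>e\<in>{e. y e \<noteq> 0}. {e'. D e e' \<noteq> 0})"
  proof
    fix e' assume "e' \<in> {e'. lin_ext D y e' \<noteq> 0}"
    then obtain e where "y e \<noteq> 0" "y e * D e e' \<noteq> 0"
      unfolding lin_ext_def using sum.not_neutral_contains_not_neutral by force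
    then show "e' \<in> (\<Union>e\<in>{e. y e \<noteq> 0}. {e'. D e e' \<noteq> 0})" by auto
  qed
  moreover have "finite (\<Union>e\<in>{e. y e \<noteq> 0}. {e'. D e e' \<noteq> 0})"
    using y De by (auto simp: free_module_def)
  moreover have "(\<Union>e\<in>{e. y e \<noteq> 0}. {e'. D e e' \<noteq> 0}) \<subseteq> chain_labels i"
    using De by (fastforce simp: free_module_def)
  ultimately show ?thesis
    unfolding free_module_def by (auto intro: finite_subset)
qed

text \<open>Every letter extends the empty chain, so in homological degree 0 only the empty word gives a
  reduced basis element.\<close>

lemma reduced_0:
  assumes t: "t \<in> reduced 0" and zero: "coord [] (t (to_nat ([]::'w list))) = 0"
  shows "t = 0"
proof -
  have "t \<in> basis_span 0 (\<lambda>_ _. False)"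
    unfolding basis_span_iff
  proof (intro conjI ballI impI)
    show "t \<in> free_module (chain_labels 0)" using t unfolding reduced_def by (rule basis_span_free)
    fix c u assume cu: "c \<in> chains 0" "u \<in> N" "coord u (t (to_nat c)) \<noteq> 0"
    then have c: "c = []" by (simp add: chains_0)
    have "[hd u] \<in> chains (Suc 0)" if "u \<noteq> []"
      using normal_set[OF cu(2)] that by (cases u) (auto simp: chains_def)
    moreover have "u = [] \<or> [hd u] \<notin> chains (Suc 0)"
      using t cu unfolding reduced_def basis_span_iff c by fastforce
    ultimately show False using cu zero c by auto
  qed
  then show ?thesis by (simp add: basis_span_def)
qed

lemma augmentation_boundary:
  assumes D: "leading 0 D" and y: "y \<in> free_module (chain_labels (Suc 0))"
  shows "coord [] (lin_ext D y (to_nat ([]::'w list))) = 0"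
proof -
  let ?S = "{y \<in> free_module (chain_labels (Suc 0)). coord [] (lin_ext D y (to_nat ([]::'w list))) = 0}"
  have "basis_span (Suc 0) (\<lambda>_ _. True) \<subseteq> ?S"
  proof (rule basis_span_minimal)
    show "fs.subspace ?S"
      using subspace_coord_lin_ext[of _ _ _ _ 0] by simp
  next
    fix c u assume c: "c \<in> chains (Suc 0)" and u: "u \<in> N"
    obtain c' p where c': "c = c' @ [p]" "c' \<in> chains 0" "p \<in> W" using chainsE[OF c] by metis
    let ?P = "\<lambda>v::'w list. v \<noteq> []"
    have P: "down_closed ?P" using lt_length by (fastforce simp: down_closed_def)
    have "lin_ext D (basis_elt c u) - single (to_nat c') (val (p # u)) \<in> word_span 0 (\<lambda>v. v \<prec> c' @ p # u)"
      using lin_ext_basis_elt[OF D c[unfolded c'] normal_set[OF u]] c' by simp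
    also have "word_span 0 (\<lambda>v. v \<prec> c' @ p # u) \<subseteq> word_span 0 ?P"
      using lt_length by (intro basis_span_mono) fastforce
    finally have "lin_ext D (basis_elt c u) - single (to_nat c') (val (p # u)) + single (to_nat c') (val (p # u))
        \<in> word_span 0 ?P"
      using single_in_word_span[OF c'(2) _ P, of "p # u"] c' normal_set[OF u]
      by (intro fs.subspace_add[OF subspace_basis_span]) auto
    then have "lin_ext D (basis_elt c u) \<in> word_span 0 ?P" by simp
    then have "coord [] (lin_ext D (basis_elt c u) (to_nat ([]::'w list))) = 0"
      unfolding basis_span_iff using chains_0 normal_Nil by fastforce
    then show "basis_elt c u \<in> ?S" using basis_elt_free[OF c] by simp
  qed
  then show ?thesis using y basis_span_True by blast
qed

section \<open>The resolution\<close>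

text \<open>The differentials are chosen one after the other. In degree 0 the leading terms alone will do,
  and boundaries have augmentation 0, so a reduced boundary is zero. Later on, boundaries are cycles, and reduced
  cycles vanish.\<close>

lemma linear_differentials:
  "\<exists>D. \<forall>i. leading i (D i) \<and> (\<forall>e\<in>chain_labels (Suc (Suc i)). lin_ext (D i) (D (Suc i) e) = 0)"
proof -
  let ?P = "\<lambda>i D. leading i D \<and>
    (\<forall>y\<in>free_module (chain_labels (Suc i)). lin_ext D y \<in> reduced i \<longrightarrow> lin_ext D y = 0)"
  let ?Q = "\<lambda>i D D'. \<forall>e\<in>chain_labels (Suc (Suc i)). lin_ext D (D' e) = 0"
  have "\<exists>D. \<forall>i. ?P i (D i) \<and> ?Q i (D i) (D (Suc i))"
  proof (rule dependent_nat_choice)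
    \<comment> \<open>A chain of length 1 is a letter; the first differential sends it to its value.\<close>
    let ?D = "\<lambda>e. basis_elt [] (from_nat e)"
    have "leading 0 ?D"
      unfolding leading_def
    proof
      fix c assume "c \<in> chains (Suc 0)"
      then obtain p where "c = [p]" by (cases c rule: rev_cases) (auto simp: chains_def)
      then show "?D (to_nat c) - basis_elt (butlast c) [last c] \<in> word_span 0 (\<lambda>v. v \<prec> c)"
        using fs.subspace_0[OF subspace_basis_span] by simp
    qed
    then show "\<exists>D. ?P 0 D"
      using reduced_0 augmentation_boundary by blast
  next
    fix D i assume D: "?P i D"
    then obtain D' where D': "leading (Suc i) D'" "\<forall>e\<in>chain_labels (Suc (Suc i)). lin_ext D (D' e) = 0"
      using extend_differential[of i D] by blast
    have "lin_ext D' y = 0"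
      if y: "y \<in> free_module (chain_labels (Suc (Suc i)))" "lin_ext D' y \<in> reduced (Suc i)" for y
    proof (rule reduced_kernel[OF _ y(2)])
      show "leading i D" using D by simp
      have "e \<in> chain_labels (Suc (Suc i))" if "y e \<noteq> 0" for e
        using y(1) that by (auto simp: free_module_def)
      then show "lin_ext D (lin_ext D' y) = 0"
        using leading_degree[OF D'(1)] D'(2)
        by (intro lin_ext_comp_zero free_finite[OF y(1)])
          (auto simp: free_component_def free_module_def)
    qed
    then show "\<exists>D'. ?P (Suc i) D' \<and> ?Q i D D'" using D' by blast
  qed
  then show ?thesis by blast
qed

text \<open>The generators in homological degree \<open>i\<close> have degree \<open>i\<close>, so the complex that computes Tor is zero
  in all other internal degrees.\<close>

theorem koszul: "koszul scale A"
proof -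
  obtain D where D: "\<And>i. leading i (D i)"
    and complex: "\<And>i e. e \<in> chain_labels (Suc (Suc i)) \<Longrightarrow> lin_ext (D i) (D (Suc i) e) = 0"
    using linear_differentials by blast
  define e0 where "e0 = to_nat ([]::'w list)"
  have X0: "chain_labels 0 = {e0}" by (simp add: chain_labels_def chains_0 e0_def)
  \<comment> \<open>Constant, because \<open>e0\<close> is the only label in homological degree 0.\<close>
  define \<eta> :: "nat \<Rightarrow> 'k" where "\<eta> = (\<lambda>_. 1)"
  have aug: "(\<Sum>e | f e \<noteq> 0. augmentation scale A (f e) * \<eta> e) = coord [] (f e0)"
    if "f \<in> free_module (chain_labels 0)" for f
  proof -
    have "{e. f e \<noteq> 0} \<subseteq> {e0}" using that by (auto simp: free_module_def X0)
    then have "(\<Sum>e | f e \<noteq> 0. augmentation scale A (f e) * \<eta> e) =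
        (\<Sum>e\<in>{e0}. augmentation scale A (f e) * \<eta> e)"
      by (intro sum.mono_neutral_left) (auto simp: augmentation_eq)
    then show ?thesis by (simp add: augmentation_eq \<eta>_def)
  qed
  have single_free: "single e0 a \<in> free_module (chain_labels 0)" for a :: 'a
    by (simp add: free_module_def supp_single X0)
  have "graded_free_resolution scale A chain_labels (\<lambda>i _. i) D \<eta>"
  proof unfold_locales
    show "e \<in> chain_labels (Suc i) \<Longrightarrow> D i e \<in> free_component A (chain_labels i) (\<lambda>_. i) (Suc i)" for e i
      using leading_degree[OF D] .
    have "c \<in> (\<lambda>f. \<Sum>e | f e \<noteq> 0. augmentation scale A (f e) * \<eta> e) ` free_module (chain_labels 0)" for c
    proof (rule image_eqI[OF _ single_free])
      show "c = (\<Sum>e | single e0 (scale c 1) e \<noteq> 0. augmentation scale A (single e0 (scale c 1) e) * \<eta> e)"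
        using coord_val[OF normal_Nil normal_Nil] by (subst aug[OF single_free]) (simp add: single_def)
    qed
    then show "(\<lambda>f. \<Sum>e | f e \<noteq> 0. augmentation scale A (f e) * \<eta> e) ` free_module (chain_labels 0) = UNIV"
      by blast
    show "lin_ext (D 0) ` free_module (chain_labels 1) =
        {f \<in> free_module (chain_labels 0). (\<Sum>e | f e \<noteq> 0. augmentation scale A (f e) * \<eta> e) = 0}" (is "?im = ?ker")
    proof
      show "?im \<subseteq> ?ker"
        using lin_ext_free[OF D, of _ 0] augmentation_boundary[OF D] by (auto simp: aug e0_def)
      show "?ker \<subseteq> ?im"
      proof
        fix f assume "f \<in> ?ker"
        then have f: "f \<in> free_module (chain_labels 0)" "coord [] (f e0) = 0" by (auto simp: aug)
        have "down_closed (\<lambda>_. True)" by (simp add: down_closed_def)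
        then obtain y where y: "y \<in> free_module (chain_labels (Suc 0))" "f - lin_ext (D 0) y \<in> reduced 0"
          using reduce[OF D[of 0], of "\<lambda>_. True" f] f(1) unfolding basis_span_True by blast
        have "f - lin_ext (D 0) y = 0"
          using f(2) augmentation_boundary[OF D y(1)] by (intro reduced_0 y) (simp add: e0_def)
        then show "f \<in> ?im" using y(1) by auto
      qed
    qed
    show "lin_ext (D (Suc i)) ` free_module (chain_labels (Suc (Suc i))) =
        {f \<in> free_module (chain_labels (Suc i)). lin_ext (D i) f = (\<lambda>_. 0)}" (is "?im = ?ker") for i
    proof
      show "?im \<subseteq> ?ker"
      proof
        fix f assume "f \<in> ?im"
        then obtain y where y: "y \<in> free_module (chain_labels (Suc (Suc i)))" "f = lin_ext (D (Suc i)) y" by blast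
        have "e \<in> chain_labels (Suc (Suc i))" if "y e \<noteq> 0" for e
          using y(1) that by (auto simp: free_module_def)
        then have "lin_ext (D i) f = 0"
          unfolding y(2) using leading_degree[OF D] complex
          by (intro lin_ext_comp_zero free_finite[OF y(1)])
            (auto simp: free_component_def free_module_def)
        then show "f \<in> ?ker" using lin_ext_free[OF D y(1)] y(2) by (simp add: zero_fun_def)
      qed
      show "?ker \<subseteq> ?im"
      proof
        fix f assume "f \<in> ?ker"
        then have f: "f \<in> free_module (chain_labels (Suc i))" "lin_ext (D i) f = 0"
          by (auto simp: zero_fun_def)
        have "down_closed (\<lambda>_. True)" by (simp add: down_closed_def)
        then obtain y where y: "y \<in> free_module (chain_labels (Suc (Suc i)))"
            "f - lin_ext (D (Suc i)) y \<in> reduced (Suc i)"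
          using reduce[OF D[of "Suc i"], of "\<lambda>_. True" f] f(1) unfolding basis_span_True by blast
        have im: "lin_ext (D (Suc i)) y \<in> ?ker" using \<open>?im \<subseteq> ?ker\<close> y(1) by blast
        have "lin_ext (D i) (f - lin_ext (D (Suc i)) y) = 0"
          using f im by (subst lin_ext_diff[OF f(1)]) (auto simp: zero_fun_def)
        then have "f - lin_ext (D (Suc i)) y = 0"
          by (rule reduced_kernel[OF D y(2)])
        then show "f \<in> ?im" using y(1) by auto
      qed
    qed
  qed simp
  moreover have "is_singleton (tor scale A chain_labels (\<lambda>i _. i) D i n)" if "n \<noteq> i" for i n
  proof -
    have "{e \<in> chain_labels i. i = n} = {}" using that by simp
    moreover have "free_module {} = {\<lambda>_::nat. 0 :: 'k}"
      by (auto simp: free_module_def)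
    ultimately have "tensor_component chain_labels (\<lambda>i _. i) i n = {\<lambda>_. 0 :: 'k}"
      unfolding tensor_component_def by (simp only:)
    moreover have "tensor_differential scale A D m (\<lambda>_. 0) = (\<lambda>_. 0)" for m
      by (simp add: tensor_differential_def lin_ext_def)
    ultimately have "tor_cycles scale A chain_labels (\<lambda>i _. i) D i n = {\<lambda>_. 0}"
      unfolding tor_cycles_def by auto
    moreover have "is_singleton ({z} // r)" for z :: "nat \<Rightarrow> 'k" and r
      by (simp add: quotient_def)
    ultimately show ?thesis unfolding tor_def by simp
  qed
  ultimately show ?thesis
    unfolding koszul_def connected_graded_def
    using graded_comm_algebra_axioms component_0 generated by blast
qed

end


section \<open>Chains in finite posets and linear extensions\<close>

lemma chain_has_greatest:
  fixes S :: "'s::{finite,order} set"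
  assumes "totally_ordered S" "S \<noteq> {}"
  obtains m where "m \<in> S" "\<And>\<sigma>. \<sigma> \<in> S \<Longrightarrow> \<sigma> \<le> m"
proof -
  obtain m where m: "m \<in> S" "\<forall>\<sigma>\<in>S. m \<le> \<sigma> \<longrightarrow> m = \<sigma>"
    using finite_has_maximal[of S] assms(2) by auto
  then have "\<sigma> \<le> m" if "\<sigma> \<in> S" for \<sigma>
    using assms(1) that unfolding totally_ordered_def by blast
  then show ?thesis using m that by blast
qed

lemma chain_has_least:
  fixes S :: "'s::{finite,order} set"
  assumes "totally_ordered S" "S \<noteq> {}"
  obtains m where "m \<in> S" "\<And>\<sigma>. \<sigma> \<in> S \<Longrightarrow> m \<le> \<sigma>"
proof -
  obtain m where m: "m \<in> S" "\<forall>\<sigma>\<in>S. \<sigma> \<le> m \<longrightarrow> m = \<sigma>"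
    using finite_has_minimal[of S] assms(2) by auto
  then have "m \<le> \<sigma>" if "\<sigma> \<in> S" for \<sigma>
    using assms(1) that unfolding totally_ordered_def by blast
  then show ?thesis using m that by blast
qed

lemma totally_ordered_subset: "totally_ordered S \<Longrightarrow> T \<subseteq> S \<Longrightarrow> totally_ordered T"
  unfolding totally_ordered_def by blast

text \<open>Counting the smaller elements is strictly monotone; ties are broken by an enumeration.\<close>

lemma linear_extension:
  "\<exists>k :: 's::{finite,order} \<Rightarrow> nat. inj k \<and> (\<forall>\<sigma> \<tau>. \<sigma> < \<tau> \<longrightarrow> k \<sigma> < k \<tau>)"
proof -
  define h where "h \<sigma> = card {\<rho>. \<rho> < \<sigma>}" for \<sigma> :: 's
  define n where "n = Suc (Max (range (to_nat :: 's \<Rightarrow> nat)))"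
  have n: "to_nat \<sigma> < n" for \<sigma> :: 's
    unfolding n_def by (simp add: less_Suc_eq_le)
  define k where "k \<sigma> = h \<sigma> * n + to_nat \<sigma>" for \<sigma>
  have "k \<sigma> mod n = to_nat \<sigma>" for \<sigma>
    using n[of \<sigma>] by (simp add: k_def)
  then have "inj k" by (metis injI from_nat_to_nat)
  moreover have "k \<sigma> < k \<tau>" if "\<sigma> < \<tau>" for \<sigma> \<tau>
  proof -
    have "h \<sigma> < h \<tau>"
      unfolding h_def using that by (intro psubset_card_mono) (auto intro: order.strict_trans)
    then have "(h \<sigma> + 1) * n \<le> h \<tau> * n" by (intro mult_right_mono) auto
    then show ?thesis using n[of \<sigma>] by (simp add: k_def)
  qed
  ultimately show ?thesis by blast
qed

text \<open>A fixed linear extension of the poset, given by the positions of the elements.\<close>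

definition key :: "'s::{finite,order} \<Rightarrow> nat" where
  "key = (SOME k. inj k \<and> (\<forall>\<sigma> \<tau>. \<sigma> < \<tau> \<longrightarrow> k \<sigma> < k \<tau>))"

lemma inj_key: "inj key" and key_mono: "\<sigma> < \<tau> \<Longrightarrow> key \<sigma> < key \<tau>"
  using someI_ex[OF linear_extension] unfolding key_def by auto

lemma key_eq_iff [simp]: "key \<sigma> = key \<tau> \<longleftrightarrow> \<sigma> = \<tau>"
  by (rule inj_eq[OF inj_key])

lemma key_mono_le: "\<sigma> \<le> \<tau> \<Longrightarrow> key \<sigma> \<le> key \<tau>"
  using key_mono[of \<sigma> \<tau>] by (auto simp: order.order_iff_strict)

lemma refines_order_key: "refines_order {(\<sigma>, \<tau>). key \<sigma> \<le> key \<tau>}"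
  unfolding refines_order_def linear_order_on_def partial_order_on_def preorder_on_def
  using key_mono_le by (auto simp: refl_on_def trans_def antisym_def total_on_def)

section \<open>The reverse lexicographic order\<close>

definition rlex :: "('s::{finite,order} \<Rightarrow> rat) \<Rightarrow> ('s \<Rightarrow> rat) \<Rightarrow> bool" where
  "rlex f g \<longleftrightarrow> (\<exists>\<sigma>. f \<sigma> < g \<sigma> \<and> (\<forall>\<tau>. key \<sigma> < key \<tau> \<longrightarrow> f \<tau> = g \<tau>))"

lemma rlex_irrefl: "\<not> rlex f f"
  by (simp add: rlex_def)

lemma rlex_trans:
  assumes "rlex f g" "rlex g h"
  shows "rlex f h"
proof -
  obtain \<sigma> \<tau> where \<sigma>: "f \<sigma> < g \<sigma>" "\<forall>\<rho>. key \<sigma> < key \<rho> \<longrightarrow> f \<rho> = g \<rho>"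
    and \<tau>: "g \<tau> < h \<tau>" "\<forall>\<rho>. key \<tau> < key \<rho> \<longrightarrow> g \<rho> = h \<rho>"
    using assms unfolding rlex_def by blast
  consider "key \<sigma> < key \<tau>" | "key \<tau> < key \<sigma>" | "\<sigma> = \<tau>"
    using inj_key by (metis injD nat_neq_iff)
  then show ?thesis
  proof cases
    case 1
    then show ?thesis unfolding rlex_def using \<sigma> \<tau> by (intro exI[of _ \<tau>]) auto
  next
    case 2
    then show ?thesis unfolding rlex_def using \<sigma> \<tau> by (intro exI[of _ \<sigma>]) auto
  next
    case 3
    then show ?thesis unfolding rlex_def using \<sigma> \<tau> by (intro exI[of _ \<sigma>]) auto
  qed
qed

lemma rlex_add: "rlex (f + h) (g + h) \<longleftrightarrow> rlex f g"
  by (simp add: rlex_def)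

lemma path_le_imp_rlex:
  assumes "path_le f g"
  shows "f = g \<or> rlex f g"
proof -
  have "rlex_le {(\<sigma>, \<tau>). key \<sigma> \<le> key \<tau>} f g"
    using assms refines_order_key unfolding path_le_def by blast
  then show ?thesis
    unfolding rlex_le_def rlex_def by (auto simp: not_le[symmetric])
qed

text \<open>The part \<open>s\<close> at the top of \<open>R + s\<close> dominates every \<open>q \<le> R + s\<close> of the same mass. Suppose that \<open>q\<close>
  is larger than \<open>s\<close> at the highest place \<open>\<sigma>\<close> where they differ. Then \<open>\<sigma>\<close> is in the support of \<open>R\<close>, thus below all of \<open>s\<close>,
  and from \<open>\<sigma>\<close> upwards \<open>q\<close> already has more mass than
  all of \<open>s\<close>, a contradiction.\<close>

lemma rlex_greatest_part:
  fixes q s R :: "'s::{finite,order} \<Rightarrow> rat"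
  assumes nonneg: "\<And>\<sigma>. 0 \<le> q \<sigma>"
    and below: "\<And>\<sigma> \<tau>. \<sigma> \<in> supp R \<Longrightarrow> \<tau> \<in> supp s \<Longrightarrow> \<sigma> \<le> \<tau>"
    and le: "\<And>\<sigma>. q \<sigma> \<le> R \<sigma> + s \<sigma>"
    and mass: "(\<Sum>\<sigma>\<in>UNIV. q \<sigma>) = (\<Sum>\<sigma>\<in>UNIV. s \<sigma>)"
  shows "q = s \<or> rlex q s"
proof (rule ccontr)
  assume contra: "\<not> (q = s \<or> rlex q s)"
  let ?K = "key ` {\<sigma>. q \<sigma> \<noteq> s \<sigma>}"
  have "?K \<noteq> {}" using contra by auto
  then have "Max ?K \<in> ?K" by (intro Max_in) auto
  then obtain \<sigma> where \<sigma>: "q \<sigma> \<noteq> s \<sigma>" "key \<sigma> = Max ?K" by auto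
  have above: "q \<tau> = s \<tau>" if "key \<sigma> < key \<tau>" for \<tau>
    using that \<sigma>(2) Max_ge[of ?K "key \<tau>"] by fastforce
  then have gt: "s \<sigma> < q \<sigma>"
    using contra \<sigma>(1) unfolding rlex_def by (meson linorder_neqE)
  then have "\<sigma> \<in> supp R" using le[of \<sigma>] by (auto simp: supp_def)
  then have supp_s: "key \<sigma> \<le> key \<tau>" if "s \<tau> \<noteq> 0" for \<tau>
    using below that by (intro key_mono_le) (auto simp: supp_def)
  let ?U = "{\<tau>::'s. key \<sigma> \<le> key \<tau>}"
  have "(\<Sum>\<tau>\<in>UNIV. s \<tau>) = (\<Sum>\<tau>\<in>?U. s \<tau>)"
    using supp_s by (intro sum.mono_neutral_right) auto
  also have "\<dots> < (\<Sum>\<tau>\<in>?U. q \<tau>)"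
  proof (rule sum_strict_mono_ex1)
    show "\<forall>\<tau>\<in>?U. s \<tau> \<le> q \<tau>"
    proof
      fix \<tau> assume "\<tau> \<in> ?U"
      then have "\<tau> = \<sigma> \<or> key \<sigma> < key \<tau>" using inj_key by (auto simp: inj_eq le_less)
      then show "s \<tau> \<le> q \<tau>" using gt above by fastforce
    qed
  qed (use gt in auto)
  also have "\<dots> \<le> (\<Sum>\<tau>\<in>UNIV. q \<tau>)"
    using nonneg by (intro sum_mono2) auto
  finally show False using mass by simp
qed

section \<open>Ordering words of functions\<close>

text \<open>The letter at position \<open>k\<close>, counted from 0, has weight \<open>k\<close>.\<close>

fun position_sum :: "('s \<Rightarrow> rat) list \<Rightarrow> 's \<Rightarrow> rat" where
  "position_sum [] = 0"
| "position_sum (p # w) = position_sum w + sum_list w"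

text \<open>Larger sums make smaller words. Among words with the same sum and length, putting more mass
  into the later letters makes a word smaller. Both keys are additive up to terms that depend only on the context, the
  length and the sum, which gives compatibility with concatenation.\<close>

definition word_less :: "('s::{finite,order} \<Rightarrow> rat) list \<Rightarrow> ('s \<Rightarrow> rat) list \<Rightarrow> bool" where
  "word_less u v \<longleftrightarrow> length u = length v \<and>
     (rlex (sum_list v) (sum_list u) \<or>
      sum_list u = sum_list v \<and> rlex (position_sum v) (position_sum u))"

lemma position_sum_append:
  "position_sum (u @ v) = position_sum u + position_sum v + (\<lambda>\<sigma>. of_nat (length u) * sum_list v \<sigma>)"
  by (induction u) (auto simp: fun_eq_iff algebra_simps)

lemma word_less_context:
  assumes "word_less u v"
  shows "word_less (a @ u @ b) (a @ v @ b)"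
proof -
  have 1: "sum_list (a @ w @ b) = sum_list w + (sum_list a + sum_list b)" for w :: "('a \<Rightarrow> rat) list"
    by (simp add: algebra_simps)
  have 2: "position_sum (a @ w @ b) = position_sum w +
      (position_sum a + position_sum b + (\<lambda>\<sigma>. of_nat (length w) * sum_list b \<sigma>) +
       (\<lambda>\<sigma>. of_nat (length a) * (sum_list w + sum_list b) \<sigma>))" for w :: "('a \<Rightarrow> rat) list"
    by (simp add: position_sum_append algebra_simps)
  show ?thesis
    using assms unfolding word_less_def 1 2 rlex_add by (auto simp: rlex_add)
qed

lemma path_sum_mset: "path_sum (mset u) = sum_list u"
  by (induction u) (auto simp: path_sum_def fun_eq_iff)

section \<open>LS-paths by cumulative sums\<close>

definition cumul :: "('s::{finite,order} \<Rightarrow> rat) \<Rightarrow> 's \<Rightarrow> rat" where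
  "cumul \<pi> \<sigma> = (\<Sum>\<rho> | \<rho> \<le> \<sigma>. \<pi> \<rho>)"

text \<open>The set \<open>S\<close> is meant to be a chain, the support of an LS-path.\<close>

definition consecutive :: "'s::order set \<Rightarrow> 's \<Rightarrow> 's \<Rightarrow> bool" where
  "consecutive S \<sigma> \<tau> \<longleftrightarrow> \<sigma> \<in> S \<and> \<tau> \<in> S \<and> \<sigma> < \<tau> \<and> (\<forall>\<rho>\<in>S. \<not> (\<sigma> < \<rho> \<and> \<rho> < \<tau>))"

lemma chain_enumeration:
  fixes S :: "'s::{finite,order} set"
  assumes "totally_ordered S"
  shows "\<exists>xs. set xs = S \<and> sorted_wrt (<) xs"
proof -
  have "finite S" by simp
  then show ?thesis using assms
  proof (induction S rule: finite_ranking_induct[where f = key])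
    case (insert x S)
    then obtain xs where xs: "set xs = S" "sorted_wrt (<) xs"
      using totally_ordered_subset[of "insert x S" S] by blast
    show ?case
    proof (cases "x \<in> S")
      case True
      then show ?thesis using xs by (auto simp: insert_absorb)
    next
      case False
      have "y < x" if "y \<in> S" for y
      proof -
        have "y \<le> x \<or> x \<le> y" using insert.prems that unfolding totally_ordered_def by blast
        then show ?thesis using insert.hyps(2)[OF that] key_mono[of x y] False that
          by (metis leD order.order_iff_strict)
      qed
      then show ?thesis using xs by (intro exI[of _ "xs @ [x]"]) (auto simp: sorted_wrt_append)
    qed
  qed auto
qed

lemma sum_enumeration:
  fixes \<pi> :: "'s::{finite,order} \<Rightarrow> rat"
  assumes xs: "set xs = supp \<pi>" "sorted_wrt (<) xs"
  shows "k < length xs \<Longrightarrow> (\<Sum>i\<le>k. \<pi> (xs ! i)) = cumul \<pi> (xs ! k)"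
    and "(\<Sum>i<length xs. \<pi> (xs ! i)) = (\<Sum>\<sigma>\<in>UNIV. \<pi> \<sigma>)"
proof -
  have less: "xs ! i < xs ! j" if "i < j" "j < length xs" for i j
    using xs(2) that by (simp add: sorted_wrt_nth_less)
  have inj: "inj_on ((!) xs) {..<length xs}"
  proof (rule inj_onI)
    fix i j assume "i \<in> {..<length xs}" "j \<in> {..<length xs}" "xs ! i = xs ! j"
    then show "i = j" using less[of i j] less[of j i] by (metis lessThan_iff less_irrefl nat_neq_iff)
  qed
  have "(\<Sum>\<sigma>\<in>UNIV. \<pi> \<sigma>) = (\<Sum>\<sigma>\<in>(!) xs ` {..<length xs}. \<pi> \<sigma>)"
  proof (rule sum.mono_neutral_right)
    have "(!) xs ` {..<length xs} = supp \<pi>" using xs(1) by (auto simp: set_conv_nth)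
    then show "\<forall>\<sigma>\<in>UNIV - (!) xs ` {..<length xs}. \<pi> \<sigma> = 0" by (auto simp: supp_def)
  qed auto
  then show "(\<Sum>i<length xs. \<pi> (xs ! i)) = (\<Sum>\<sigma>\<in>UNIV. \<pi> \<sigma>)"
    by (simp add: sum.reindex[OF inj])
  assume k: "k < length xs"
  have "{\<rho> \<in> supp \<pi>. \<rho> \<le> xs ! k} = (!) xs ` {..k}"
  proof (intro equalityI subsetI)
    fix \<rho> assume "\<rho> \<in> {\<rho> \<in> supp \<pi>. \<rho> \<le> xs ! k}"
    then have "\<rho> \<in> set xs" and le: "\<rho> \<le> xs ! k" using xs(1) by auto
    then obtain i where i: "i < length xs" "\<rho> = xs ! i" by (metis in_set_conv_nth)
    then have "\<not> k < i" using less[of k i] le by (auto dest: leD)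
    then have "i \<le> k" by simp
    then show "\<rho> \<in> (!) xs ` {..k}" using i by auto
  next
    fix \<rho> assume "\<rho> \<in> (!) xs ` {..k}"
    then obtain i where i: "i \<le> k" "\<rho> = xs ! i" by auto
    then have "xs ! i \<le> xs ! k" using less[of i k] k by (cases "i = k") auto
    moreover have "\<rho> \<in> set xs" unfolding i(2) using i(1) k by (intro nth_mem) simp
    ultimately show "\<rho> \<in> {\<rho> \<in> supp \<pi>. \<rho> \<le> xs ! k}" unfolding xs(1) i(2) by blast
  qed
  moreover have "cumul \<pi> (xs ! k) = (\<Sum>\<rho>\<in>{\<rho> \<in> supp \<pi>. \<rho> \<le> xs ! k}. \<pi> \<rho>)"
    unfolding cumul_def by (intro sum.mono_neutral_right) (auto simp: supp_def)
  moreover have "inj_on ((!) xs) {..k}" using inj k by (auto simp: inj_on_def)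
  ultimately show "(\<Sum>i\<le>k. \<pi> (xs ! i)) = cumul \<pi> (xs ! k)"
    by (simp add: sum.reindex)
qed

lemma consecutive_enumeration:
  fixes xs :: "'s::order list"
  assumes "sorted_wrt (<) xs"
  shows "consecutive (set xs) \<sigma> \<tau> \<longleftrightarrow>
    (\<exists>k. Suc k < length xs \<and> \<sigma> = xs ! k \<and> \<tau> = xs ! Suc k)"
proof -
  have less: "xs ! i < xs ! j" if "i < j" "j < length xs" for i j
    using assms that by (simp add: sorted_wrt_nth_less)
  have less_iff: "xs ! i < xs ! j \<longleftrightarrow> i < j" if "i < length xs" "j < length xs" for i j
    using less[of i j] less[of j i] that by (cases i j rule: linorder_cases) (auto dest: order.asym)
  show ?thesis
  proof
    assume c: "consecutive (set xs) \<sigma> \<tau>"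
    then obtain k l where kl: "k < length xs" "\<sigma> = xs ! k" "l < length xs" "\<tau> = xs ! l"
      unfolding consecutive_def by (metis in_set_conv_nth)
    then have "k < l" using c less_iff unfolding consecutive_def by blast
    moreover have "\<not> Suc k < l"
    proof
      assume "Suc k < l"
      then have "xs ! k < xs ! Suc k \<and> xs ! Suc k < xs ! l \<and> xs ! Suc k \<in> set xs"
        using less kl by auto
      then show False using c kl unfolding consecutive_def by blast
    qed
    ultimately have "l = Suc k" by simp
    then show "\<exists>k. Suc k < length xs \<and> \<sigma> = xs ! k \<and> \<tau> = xs ! Suc k" using kl by blast
  next
    assume "\<exists>k. Suc k < length xs \<and> \<sigma> = xs ! k \<and> \<tau> = xs ! Suc k"
    then obtain k where k: "Suc k < length xs" "\<sigma> = xs ! k" "\<tau> = xs ! Suc k" by blast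
    have "\<not> (\<sigma> < \<rho> \<and> \<rho> < \<tau>)" if "\<rho> \<in> set xs" for \<rho>
    proof -
      obtain l where "l < length xs" "\<rho> = xs ! l" using \<open>\<rho> \<in> set xs\<close> by (metis in_set_conv_nth)
      then show ?thesis using k less_iff[of k l] less_iff[of l "Suc k"] by auto
    qed
    then show "consecutive (set xs) \<sigma> \<tau>" using k less[of k "Suc k"] by (auto simp: consecutive_def)
  qed
qed

text \<open>The integrality condition refers to neighbours in the support, so it can be stated without
  enumerating the support.\<close>

lemma ls_path_iff:
  fixes \<pi> :: "'s::{finite,order} \<Rightarrow> rat"
  shows "ls_path b r \<pi> \<longleftrightarrow> (\<forall>\<sigma>. 0 \<le> \<pi> \<sigma>) \<and> totally_ordered (supp \<pi>) \<and>
    (\<forall>\<sigma> \<tau>. consecutive (supp \<pi>) \<sigma> \<tau> \<longrightarrow> of_nat (bond b \<sigma> \<tau>) * cumul \<pi> \<sigma> \<in> \<nat>) \<and>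
    (\<Sum>\<sigma>\<in>UNIV. \<pi> \<sigma>) = of_nat r"
proof -
  have "(\<forall>k. Suc k < length xs \<longrightarrow>
           of_nat (bond b (xs ! k) (xs ! Suc k)) * (\<Sum>i\<le>k. \<pi> (xs ! i)) \<in> \<nat>) \<and>
        (\<Sum>i<length xs. \<pi> (xs ! i)) = of_nat r \<longleftrightarrow>
    (\<forall>\<sigma> \<tau>. consecutive (supp \<pi>) \<sigma> \<tau> \<longrightarrow> of_nat (bond b \<sigma> \<tau>) * cumul \<pi> \<sigma> \<in> \<nat>) \<and>
    (\<Sum>\<sigma>\<in>UNIV. \<pi> \<sigma>) = of_nat r"
    if xs: "set xs = supp \<pi>" "sorted_wrt (<) xs" for xs
  proof -
    have "(\<forall>k. Suc k < length xs \<longrightarrow>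
           of_nat (bond b (xs ! k) (xs ! Suc k)) * (\<Sum>i\<le>k. \<pi> (xs ! i)) \<in> \<nat>) \<longleftrightarrow>
        (\<forall>k. Suc k < length xs \<longrightarrow>
           of_nat (bond b (xs ! k) (xs ! Suc k)) * cumul \<pi> (xs ! k) \<in> \<nat>)"
      using sum_enumeration(1)[OF xs] by simp
    also have "\<dots> \<longleftrightarrow>
        (\<forall>\<sigma> \<tau>. consecutive (supp \<pi>) \<sigma> \<tau> \<longrightarrow> of_nat (bond b \<sigma> \<tau>) * cumul \<pi> \<sigma> \<in> \<nat>)"
      unfolding consecutive_enumeration[OF xs(2), unfolded xs(1)] by blast
    finally show ?thesis unfolding sum_enumeration(2)[OF xs] by (rule arg_cong)
  qed
  then show ?thesis
    unfolding ls_path_def using chain_enumeration[of "supp \<pi>"] by blast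
qed

lemma ls_pathD:
  assumes "ls_path b r \<pi>"
  shows "0 \<le> \<pi> \<sigma>" "totally_ordered (supp \<pi>)" "(\<Sum>\<sigma>\<in>UNIV. \<pi> \<sigma>) = of_nat r"
    "consecutive (supp \<pi>) \<sigma> \<tau> \<Longrightarrow> of_nat (bond b \<sigma> \<tau>) * cumul \<pi> \<sigma> \<in> \<nat>"
  using assms unfolding ls_path_iff by auto

text \<open>Integrality is a statement about cumulative sums at elements of the support; this reduces the mass strictly
  below an element to such a sum.\<close>

lemma sum_below_cases:
  fixes \<pi> :: "'s::{finite,order} \<Rightarrow> rat"
  assumes chain: "totally_ordered (supp \<pi>)"
  obtains "(\<Sum>\<rho> | \<rho> < \<sigma>. \<pi> \<rho>) = 0" "\<And>\<rho>. \<rho> \<in> supp \<pi> \<Longrightarrow> \<not> \<rho> < \<sigma>"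
  | \<rho>' where "\<rho>' \<in> supp \<pi>" "\<rho>' < \<sigma>" "\<And>\<rho>. \<rho> \<in> supp \<pi> \<Longrightarrow> \<rho> < \<sigma> \<Longrightarrow> \<rho> \<le> \<rho>'"
      "(\<Sum>\<rho> | \<rho> < \<sigma>. \<pi> \<rho>) = cumul \<pi> \<rho>'"
proof (cases "{\<rho> \<in> supp \<pi>. \<rho> < \<sigma>} = {}")
  case True
  then have "(\<Sum>\<rho> | \<rho> < \<sigma>. \<pi> \<rho>) = 0" by (intro sum.neutral) (auto simp: supp_def)
  then show ?thesis using that(1) True by blast
next
  case False
  obtain \<rho>' where \<rho>': "\<rho>' \<in> {\<rho> \<in> supp \<pi>. \<rho> < \<sigma>}" "\<And>\<rho>. \<rho> \<in> {\<rho> \<in> supp \<pi>. \<rho> < \<sigma>} \<Longrightarrow> \<rho> \<le> \<rho>'"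
    using chain_has_greatest[OF totally_ordered_subset[OF chain] False] by blast
  have "cumul \<pi> \<rho>' = (\<Sum>\<rho> | \<rho> < \<sigma>. \<pi> \<rho>)"
    unfolding cumul_def
  proof (rule sum.mono_neutral_left)
    show "{\<rho>. \<rho> \<le> \<rho>'} \<subseteq> {\<rho>. \<rho> < \<sigma>}" using \<rho>'(1) by auto
    show "\<forall>\<rho>\<in>{\<rho>. \<rho> < \<sigma>} - {\<rho>. \<rho> \<le> \<rho>'}. \<pi> \<rho> = 0" using \<rho>'(2) by (auto simp: supp_def)
  qed simp
  then show ?thesis using that(2)[of \<rho>'] \<rho>' by simp
qed

lemma cumul_top:
  assumes "\<And>\<rho>. \<rho> \<in> supp \<pi> \<Longrightarrow> \<rho> \<le> \<sigma>"
  shows "cumul \<pi> \<sigma> = (\<Sum>\<rho>\<in>UNIV. \<pi> \<rho>)"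
  unfolding cumul_def using assms by (intro sum.mono_neutral_left) (auto simp: supp_def)

lemma cumul_split: "cumul \<pi> \<sigma> = (\<Sum>\<rho> | \<rho> < \<sigma>. \<pi> \<rho>) + \<pi> \<sigma>"
proof -
  have "{\<rho>. \<rho> \<le> \<sigma>} = insert \<sigma> {\<rho>. \<rho> < \<sigma>}" by auto
  then show ?thesis by (simp add: cumul_def)
qed

section \<open>Splitting and gluing LS-paths\<close>

definition below :: "('s::order \<Rightarrow> rat) \<Rightarrow> ('s \<Rightarrow> rat) \<Rightarrow> bool" where
  "below R s \<longleftrightarrow> (\<forall>\<sigma>\<in>supp R. \<forall>\<tau>\<in>supp s. \<sigma> \<le> \<tau>)"

text \<open>The cut is at the least \<open>m\<close> in the support where the cumulative sum exceeds \<open>r\<close>; the mass at \<open>m\<close> is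
  shared. Neighbours in the support of either part are neighbours in the support of \<open>\<pi>\<close>, and the cumulative sums
  change by 0 or by the integer \<open>r\<close>, so integrality is inherited.\<close>

lemma ls_path_split:
  fixes \<pi> :: "'s::{finite,order} \<Rightarrow> rat"
  assumes \<pi>: "ls_path b (Suc r) \<pi>"
  obtains R s where "ls_path b r R" "ls_path b 1 s" "\<pi> = R + s" "below R s"
proof -
  note \<pi>D = ls_pathD[OF \<pi>]
  have "supp \<pi> \<noteq> {}"
  proof
    assume "supp \<pi> = {}"
    then have "(\<Sum>\<sigma>\<in>UNIV. \<pi> \<sigma>) = 0" by (intro sum.neutral) (auto simp: supp_def)
    then show False using \<pi>D(3) by simp
  qed
  then obtain t where t: "t \<in> supp \<pi>" "\<And>\<sigma>. \<sigma> \<in> supp \<pi> \<Longrightarrow> \<sigma> \<le> t"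
    using chain_has_greatest[OF \<pi>D(2)] by blast
  let ?M = "{\<sigma> \<in> supp \<pi>. of_nat r < cumul \<pi> \<sigma>}"
  have "cumul \<pi> t = of_nat (Suc r)" using cumul_top[OF t(2)] \<pi>D(3) by simp
  then have "t \<in> ?M" using t(1) by simp
  then have "?M \<noteq> {}" by blast
  moreover have "totally_ordered ?M" by (rule totally_ordered_subset[OF \<pi>D(2)]) simp
  ultimately obtain m where "m \<in> ?M" and m_min: "\<And>\<sigma>. \<sigma> \<in> ?M \<Longrightarrow> m \<le> \<sigma>"
    using chain_has_least[of ?M] by metis
  then have m: "m \<in> supp \<pi>" "of_nat r < cumul \<pi> m" by auto
  have m_least: "m \<le> \<sigma>" if "\<sigma> \<in> supp \<pi>" "of_nat r < cumul \<pi> \<sigma>" for \<sigma>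
    using m_min that by simp
  let ?L = "\<Sum>\<rho> | \<rho> < m. \<pi> \<rho>"
  have L: "?L \<le> of_nat r"
  proof (cases rule: sum_below_cases[OF \<pi>D(2), of m])
    case (2 \<rho>')
    then have "\<not> of_nat r < cumul \<pi> \<rho>'" using m_least[of \<rho>'] by auto
    then show ?thesis using 2 by simp
  qed simp
  define R where "R \<sigma> = (if \<sigma> < m then \<pi> \<sigma> else if \<sigma> = m then of_nat r - ?L else 0)" for \<sigma>
  define s where "s = \<pi> - R"
  have total: "\<sigma> < m \<or> \<sigma> = m \<or> m < \<sigma>" if "\<sigma> \<in> supp \<pi>" for \<sigma>
    using \<pi>D(2) m(1) that unfolding totally_ordered_def by (metis order.order_iff_strict)
  have sm: "s m = cumul \<pi> m - of_nat r"
    by (simp add: s_def R_def cumul_split)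
  have R_nonneg: "0 \<le> R \<sigma>" for \<sigma> using L \<pi>D(1) by (simp add: R_def)
  have s_nonneg: "0 \<le> s \<sigma>" for \<sigma>
    using sm m(2) \<pi>D(1)[of \<sigma>] by (cases "\<sigma> = m") (auto simp: s_def R_def)
  have supp_R: "supp R \<subseteq> {\<sigma> \<in> supp \<pi>. \<sigma> \<le> m}" "{\<sigma> \<in> supp \<pi>. \<sigma> < m} \<subseteq> supp R"
    using m(1) by (auto simp: R_def supp_def split: if_splits)
  have supp_s: "supp s = {\<sigma> \<in> supp \<pi>. m \<le> \<sigma>}"
  proof (intro equalityI subsetI)
    fix \<sigma> assume "\<sigma> \<in> supp s"
    then show "\<sigma> \<in> {\<sigma> \<in> supp \<pi>. m \<le> \<sigma>}"
      using total[of \<sigma>] m(1) by (auto simp: supp_def s_def R_def split: if_splits)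
  next
    fix \<sigma> assume "\<sigma> \<in> {\<sigma> \<in> supp \<pi>. m \<le> \<sigma>}"
    then show "\<sigma> \<in> supp s"
      using sm m(2) by (cases "\<sigma> = m") (auto simp: supp_def s_def R_def)
  qed
  have mass_R: "(\<Sum>\<sigma>\<in>UNIV. R \<sigma>) = of_nat r"
  proof -
    have "(\<Sum>\<sigma>\<in>UNIV. R \<sigma>) = cumul R m" using supp_R by (intro cumul_top[symmetric]) auto
    also have "\<dots> = of_nat r" by (simp add: cumul_split R_def)
    finally show ?thesis .
  qed
  have "ls_path b r R"
    unfolding ls_path_iff
  proof (intro conjI allI impI)
    show "totally_ordered (supp R)" using supp_R by (intro totally_ordered_subset[OF \<pi>D(2)]) auto
    fix \<sigma> \<tau> assume c: "consecutive (supp R) \<sigma> \<tau>"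
    then have \<sigma>: "\<sigma> < m" "\<sigma> \<in> supp \<pi>" "\<tau> \<in> supp \<pi>" "\<sigma> < \<tau>" "\<tau> \<le> m"
      using supp_R unfolding consecutive_def by (auto dest: order.strict_trans2)
    have "consecutive (supp \<pi>) \<sigma> \<tau>"
      unfolding consecutive_def
    proof (intro conjI ballI \<sigma>)
      fix \<rho> assume "\<rho> \<in> supp \<pi>"
      then show "\<not> (\<sigma> < \<rho> \<and> \<rho> < \<tau>)"
        using c \<sigma>(5) supp_R(2) unfolding consecutive_def by (auto dest: order.strict_trans2)
    qed
    moreover have "cumul R \<sigma> = cumul \<pi> \<sigma>"
      unfolding cumul_def using \<sigma>(1) by (intro sum.cong) (auto simp: R_def dest: order.strict_trans1)
    ultimately show "of_nat (bond b \<sigma> \<tau>) * cumul R \<sigma> \<in> \<nat>" using \<pi>D(4) by simp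
  qed (use R_nonneg mass_R in auto)
  moreover have "ls_path b 1 s"
    unfolding ls_path_iff
  proof (intro conjI allI impI)
    show "totally_ordered (supp s)" using supp_s by (intro totally_ordered_subset[OF \<pi>D(2)]) auto
    show "(\<Sum>\<sigma>\<in>UNIV. s \<sigma>) = of_nat 1"
      using \<pi>D(3) mass_R by (simp add: s_def sum_subtractf)
    fix \<sigma> \<tau> assume c: "consecutive (supp s) \<sigma> \<tau>"
    then have \<sigma>: "m \<le> \<sigma>" "\<sigma> \<in> supp \<pi>" "\<tau> \<in> supp \<pi>" "\<sigma> < \<tau>"
      using supp_s unfolding consecutive_def by auto
    have "consecutive (supp \<pi>) \<sigma> \<tau>"
      unfolding consecutive_def
    proof (intro conjI ballI \<sigma>)
      fix \<rho> assume "\<rho> \<in> supp \<pi>"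
      then show "\<not> (\<sigma> < \<rho> \<and> \<rho> < \<tau>)"
        using c \<sigma>(1) supp_s unfolding consecutive_def by (auto dest: order.strict_trans1)
    qed
    then have "of_nat (bond b \<sigma> \<tau>) * cumul \<pi> \<sigma> \<in> \<nat>" using \<pi>D(4) by simp
    moreover have "cumul s \<sigma> = cumul \<pi> \<sigma> - of_nat r"
    proof -
      have "cumul R \<sigma> = of_nat r"
        using supp_R(1) \<sigma>(1) mass_R by (subst cumul_top) (auto intro: order_trans)
      then show ?thesis by (simp add: cumul_def s_def sum_subtractf)
    qed
    ultimately have "of_nat (bond b \<sigma> \<tau>) * cumul s \<sigma> \<in> \<int>"
      by (simp add: right_diff_distrib Nats_subset_Ints[THEN subsetD])
    moreover have "0 \<le> cumul s \<sigma>" unfolding cumul_def using s_nonneg by (intro sum_nonneg) auto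
    ultimately show "of_nat (bond b \<sigma> \<tau>) * cumul s \<sigma> \<in> \<nat>"
      by (simp add: Nats_altdef2)
  qed (use s_nonneg in auto)
  moreover have "\<pi> = R + s" by (simp add: s_def)
  moreover have "below R s" using supp_R(1) supp_s by (auto simp: below_def intro: order_trans)
  ultimately show ?thesis using that by blast
qed

lemma supp_add:
  assumes "\<And>\<sigma>. 0 \<le> R \<sigma>" "\<And>\<sigma>. 0 \<le> s \<sigma>"
  shows "supp (R + s) = supp R \<union> supp s"
  using assms by (auto simp: supp_def add_nonneg_eq_0_iff)

text \<open>Neighbours of the glued path lie in the same part, where the cumulative sums differ by an integer, or
  one lies in each part; then the cumulative sum at the lower one is \<open>r\<close>.\<close>

lemma ls_path_glue:
  fixes R s :: "'s::{finite,order} \<Rightarrow> rat"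
  assumes R: "ls_path b r R" and s: "ls_path b 1 s" and RS: "below R s"
  shows "ls_path b (Suc r) (R + s)"
proof -
  note RD = ls_pathD[OF R] and sD = ls_pathD[OF s]
  have supp: "supp (R + s) = supp R \<union> supp s" using RD(1) sD(1) by (rule supp_add)
  have chain: "totally_ordered (supp (R + s))"
    using RD(2) sD(2) RS unfolding supp totally_ordered_def below_def by blast
  have "supp s \<noteq> {}"
  proof
    assume "supp s = {}"
    then have "(\<Sum>\<sigma>\<in>UNIV. s \<sigma>) = 0" by (intro sum.neutral) (auto simp: supp_def)
    then show False using sD(3) by simp
  qed
  then obtain m where m: "m \<in> supp s" "\<And>\<sigma>. \<sigma> \<in> supp s \<Longrightarrow> m \<le> \<sigma>"
    using chain_has_least[OF sD(2)] by blast
  have Rm: "\<sigma> \<le> m" if "\<sigma> \<in> supp R" for \<sigma> using RS m(1) that unfolding below_def by blast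
  have add: "cumul (R + s) \<sigma> = cumul R \<sigma> + cumul s \<sigma>" for \<sigma>
    by (simp add: cumul_def sum.distrib)
  show ?thesis
    unfolding ls_path_iff
  proof (intro conjI allI impI chain)
    show "0 \<le> (R + s) \<sigma>" for \<sigma> using RD(1) sD(1) by simp
    show "(\<Sum>\<sigma>\<in>UNIV. (R + s) \<sigma>) = of_nat (Suc r)" using RD(3) sD(3) by (simp add: sum.distrib)
    fix \<sigma> \<tau> assume c: "consecutive (supp (R + s)) \<sigma> \<tau>"
    then have \<sigma>\<tau>: "\<sigma> < \<tau>" and between: "\<And>\<rho>. \<rho> \<in> supp (R + s) \<Longrightarrow> \<not> (\<sigma> < \<rho> \<and> \<rho> < \<tau>)"
      by (auto simp: consecutive_def)
    have "m \<in> supp (R + s)" "\<sigma> \<in> supp (R + s)" "\<tau> \<in> supp (R + s)"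
      using m(1) c unfolding supp consecutive_def by auto
    then have "m \<le> \<sigma> \<or> \<sigma> < m" "m < \<tau> \<or> \<tau> \<le> m"
      using chain unfolding totally_ordered_def by (metis order.order_iff_strict)+
    then consider "m \<le> \<sigma>" | "\<sigma> < m" "\<tau> \<le> m" using between \<open>m \<in> supp (R + s)\<close> by blast
    then show "of_nat (bond b \<sigma> \<tau>) * cumul (R + s) \<sigma> \<in> \<nat>"
    proof cases
      case 1
      have in_s: "\<rho> \<in> supp s" if "\<rho> \<in> supp (R + s)" "m \<le> \<rho>" for \<rho>
        using that m(1) Rm[of \<rho>] unfolding supp by auto
      have "consecutive (supp s) \<sigma> \<tau>"
        using c 1 in_s[of \<sigma>] in_s[of \<tau>] unfolding consecutive_def supp by auto
      then have "of_nat (bond b \<sigma> \<tau>) * cumul s \<sigma> \<in> \<nat>" by (rule sD(4))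
      moreover have "cumul R \<sigma> = of_nat r"
        using RD(3) Rm 1 by (subst cumul_top) (auto intro: order_trans)
      ultimately show ?thesis by (simp add: add distrib_left)
    next
      case 2
      have s0: "cumul s \<sigma> = 0"
        unfolding cumul_def
      proof (rule sum.neutral, rule ballI)
        fix \<rho> assume "\<rho> \<in> {\<rho>. \<rho> \<le> \<sigma>}"
        then have "\<not> m \<le> \<rho>" using 2(1) by auto
        then show "s \<rho> = 0" using m(2) by (auto simp: supp_def)
      qed
      have \<sigma>R: "\<sigma> \<in> supp R" using \<open>\<sigma> \<in> supp (R + s)\<close> 2(1) m(2)[of \<sigma>] unfolding supp by auto
      show ?thesis
      proof (cases "\<tau> \<in> supp R")
        case True
        then have "consecutive (supp R) \<sigma> \<tau>"
          using c \<sigma>R unfolding consecutive_def supp by auto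
        then show ?thesis using RD(4) s0 by (simp add: add)
      next
        case False
        then have "\<tau> \<in> supp s" using \<open>\<tau> \<in> supp (R + s)\<close> unfolding supp by auto
        then have \<tau>: "\<tau> = m" using m(2) 2(2) by (simp add: order.antisym)
        have "\<rho> \<le> \<sigma>" if \<rho>: "\<rho> \<in> supp R" for \<rho>
        proof -
          have "\<rho> < m" using Rm[OF \<rho>] False \<tau> \<rho> by (metis order.order_iff_strict)
          then have "\<not> \<sigma> < \<rho>" using between[of \<rho>] \<rho> \<tau> unfolding supp by blast
          then show ?thesis using RD(2) \<rho> \<sigma>R unfolding totally_ordered_def by (metis order.order_iff_strict)
        qed
        then have "cumul R \<sigma> = of_nat r" using RD(3) by (subst cumul_top) auto
        then show ?thesis using s0 by (simp add: add)
      qed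
    qed
  qed
qed


section \<open>Canonical forms as normal words\<close>

(* Keeps the degree in LS_deg b 1 from being rewritten to a successor. *)
declare One_nat_def [simp del]

abbreviation ls_words :: "('s::{finite,order} \<Rightarrow> 's \<Rightarrow> nat) \<Rightarrow> ('s \<Rightarrow> rat) list set" where
  "ls_words b \<equiv> normal_words (LS_deg b 1) (\<lambda>p q. max_supp p \<le> min_supp q)"

lemma unit_path:
  fixes p :: "'s::{finite,order} \<Rightarrow> rat"
  assumes "p \<in> LS_deg b 1"
  shows "ls_path b 1 p" "0 \<le> p \<sigma>" "(\<Sum>\<sigma>\<in>UNIV. p \<sigma>) = 1"
    and max_supp_in: "max_supp p \<in> supp p" and max_supp_ge: "\<sigma> \<in> supp p \<Longrightarrow> \<sigma> \<le> max_supp p"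
    and min_supp_in: "min_supp p \<in> supp p" and min_supp_le: "\<sigma> \<in> supp p \<Longrightarrow> min_supp p \<le> \<sigma>"
proof -
  show p: "ls_path b 1 p" using assms by (simp add: LS_deg_def)
  note D = ls_pathD[OF p]
  show "0 \<le> p \<sigma>" "(\<Sum>\<sigma>\<in>UNIV. p \<sigma>) = 1" using D(1,3) by auto
  have ne: "supp p \<noteq> {}"
  proof
    assume "supp p = {}"
    then have "(\<Sum>\<sigma>\<in>UNIV. p \<sigma>) = 0" by (intro sum.neutral) (auto simp: supp_def)
    then show False using D(3) by simp
  qed
  obtain m where m: "m \<in> supp p" "\<And>\<sigma>. \<sigma> \<in> supp p \<Longrightarrow> \<sigma> \<le> m"
    using chain_has_greatest[OF D(2) ne] by metis
  then have "max_supp p = m" unfolding max_supp_def by (rule Greatest_equality)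
  then show "max_supp p \<in> supp p" "\<sigma> \<in> supp p \<Longrightarrow> \<sigma> \<le> max_supp p" using m by auto
  obtain n where n: "n \<in> supp p" "\<And>\<sigma>. \<sigma> \<in> supp p \<Longrightarrow> n \<le> \<sigma>"
    using chain_has_least[OF D(2) ne] by metis
  then have "min_supp p = n" unfolding min_supp_def by (rule Least_equality)
  then show "min_supp p \<in> supp p" "\<sigma> \<in> supp p \<Longrightarrow> min_supp p \<le> \<sigma>" using n by auto
qed

lemma max_le_min_iff_below:
  fixes p q :: "'s::{finite,order} \<Rightarrow> rat"
  assumes "p \<in> LS_deg b 1" "q \<in> LS_deg b 1"
  shows "max_supp p \<le> min_supp q \<longleftrightarrow> below p q"
  unfolding below_def
  using max_supp_in[OF assms(1)] max_supp_ge[OF assms(1)] min_supp_in[OF assms(2)] min_supp_le[OF assms(2)]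
  by (meson order_trans)

lemma ls_words_snoc:
  "u @ [s] \<in> ls_words b \<longleftrightarrow>
     u \<in> ls_words b \<and> s \<in> LS_deg b 1 \<and> (u = [] \<or> max_supp (last u) \<le> min_supp s)"
  by (auto simp: normal_words_def successively_append_iff)

lemma sum_list_nonneg_paths:
  fixes u :: "('s::{finite,order} \<Rightarrow> rat) list"
  assumes "set u \<subseteq> LS_deg b 1"
  shows "0 \<le> sum_list u \<sigma>"
  using assms unit_path(2) by (induction u) (auto intro!: add_nonneg_nonneg)

lemma sum_list_path:
  assumes "u \<in> ls_words b"
  shows "ls_path b (length u) (sum_list u) \<and> (\<forall>\<sigma>\<in>supp (sum_list u). \<sigma> \<le> max_supp (last u))"
  using assms
proof (induction u rule: rev_induct)
  case Nil
  have "supp (0 :: 'a \<Rightarrow> rat) = {}" by (simp add: supp_def)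
  then have "ls_path b 0 0" by (simp only: ls_path_iff) (simp add: consecutive_def totally_ordered_def)
  then show ?case using \<open>supp 0 = {}\<close> by (simp only: sum_list.Nil list.size) simp
next
  case (snoc s u)
  then have u: "u \<in> ls_words b" and s: "s \<in> LS_deg b 1"
    and last: "u = [] \<or> max_supp (last u) \<le> min_supp s"
    by (auto simp: ls_words_snoc)
  note IH = snoc.IH[OF u]
  have le: "\<sigma> \<le> min_supp s" if "\<sigma> \<in> supp (sum_list u)" for \<sigma>
    using IH last that by (cases "u = []") (auto simp: supp_def intro: order_trans)
  then have below: "below (sum_list u) s"
    unfolding below_def using min_supp_le[OF s] order_trans by blast
  have "supp (sum_list u + s) = supp (sum_list u) \<union> supp s"
    using IH unit_path(2)[OF s] ls_pathD(1) by (intro supp_add) blast+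
  then have "supp (sum_list (u @ [s])) = supp (sum_list u) \<union> supp s" by simp
  then have "\<forall>\<sigma>\<in>supp (sum_list (u @ [s])). \<sigma> \<le> max_supp s"
    using le max_supp_ge[OF s] min_supp_in[OF s] order_trans by blast
  moreover have "ls_path b (length (u @ [s])) (sum_list (u @ [s]))"
    using ls_path_glue[OF _ unit_path(1)[OF s] below] IH by simp
  ultimately show ?case by (simp only: last_snoc simp_thms)
qed

lemma below_last:
  assumes "u @ [s] \<in> ls_words b"
  shows "below (sum_list u) s"
proof -
  have u: "u \<in> ls_words b" and s: "s \<in> LS_deg b 1"
    and last: "u = [] \<or> max_supp (last u) \<le> min_supp s"
    using assms by (auto simp: ls_words_snoc)
  have "\<sigma> \<le> min_supp s" if "\<sigma> \<in> supp (sum_list u)" for \<sigma>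
    using sum_list_path[OF u] last that by (cases "u = []") (auto simp: supp_def intro: order_trans)
  then show ?thesis
    unfolding below_def using min_supp_le[OF s] order_trans by blast
qed

text \<open>Splitting off the top unit repeatedly yields the canonical form.\<close>

lemma path_has_normal_word:
  assumes "ls_path b r \<pi>"
  shows "\<exists>u\<in>ls_words b. length u = r \<and> sum_list u = \<pi>"
  using assms
proof (induction r arbitrary: \<pi>)
  case 0
  have "\<pi> \<sigma> = 0" for \<sigma>
    using ls_pathD(1,3)[OF 0] sum_nonneg_eq_0_iff[of UNIV \<pi>] by simp
  then show ?case by (intro bexI[of _ "[]"]) (auto simp: fun_eq_iff normal_words_def)
next
  case (Suc r)
  obtain R s where Rs: "ls_path b r R" "ls_path b 1 s" "\<pi> = R + s" "below R s"
    using ls_path_split[OF Suc.prems] .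
  obtain u where u: "u \<in> ls_words b" "length u = r" "sum_list u = R"
    using Suc.IH[OF Rs(1)] by blast
  have s: "s \<in> LS_deg b 1" using Rs(2) by (simp add: LS_deg_def)
  have "max_supp (last u) \<le> min_supp s" if ne: "u \<noteq> []"
  proof -
    obtain v p where v: "u = v @ [p]" using ne by (cases u rule: rev_cases) auto
    then have vp: "v \<in> ls_words b" "p \<in> LS_deg b 1" using u(1) by (auto simp: ls_words_snoc)
    have "0 \<le> sum_list v \<sigma>" for \<sigma>
      using vp(1) by (intro sum_list_nonneg_paths) (auto simp: normal_words_def)
    then have "supp (sum_list v + p) = supp (sum_list v) \<union> supp p"
      using unit_path(2)[OF vp(2)] by (intro supp_add)
    then have "supp R = supp (sum_list v) \<union> supp p" using u(3) v by auto
    then have "below p s" using Rs(4) by (auto simp: below_def)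
    then show ?thesis using max_le_min_iff_below[OF vp(2) s] v by simp
  qed
  then have "u @ [s] \<in> ls_words b" using u(1) s by (auto simp: ls_words_snoc)
  then show ?case using u Rs(3) by (intro bexI[of _ "u @ [s]"]) auto
qed

lemma length_eq_mass:
  assumes "u \<in> ls_words b"
  shows "(\<Sum>\<sigma>\<in>UNIV. sum_list u \<sigma>) = of_nat (length u)"
  using ls_pathD(3) sum_list_path[OF assms] by blast

lemma length_eq_if_sum_eq:
  assumes "u \<in> ls_words b" "v \<in> ls_words b" "sum_list u = sum_list v"
  shows "length u = length v"
  using length_eq_mass[OF assms(1)] length_eq_mass[OF assms(2)] unfolding assms(3) by simp

text \<open>The last letter of a normal word is the reverse lexicographically greatest unit path below the sum,
  so it is determined by the sum.\<close>

lemma normal_word_unique: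
  assumes "u \<in> ls_words b" "v \<in> ls_words b" "sum_list u = sum_list v"
  shows "u = v"
  using assms
proof (induction u arbitrary: v rule: rev_induct)
  case Nil
  then have "length v = 0" using length_eq_if_sum_eq[OF Nil] by simp
  then show ?case by simp
next
  case (snoc s u)
  have "length v = length (u @ [s])"
    using length_eq_if_sum_eq[OF snoc.prems] by (rule sym)
  then obtain w q where v: "v = w @ [q]" by (cases v rule: rev_cases) auto
  have in_words: "u \<in> ls_words b" "s \<in> LS_deg b 1" "w \<in> ls_words b" "q \<in> LS_deg b 1"
    using snoc.prems v by (auto simp: ls_words_snoc)
  have sum: "sum_list u \<sigma> + s \<sigma> = sum_list w \<sigma> + q \<sigma>" for \<sigma>
    using fun_cong[OF snoc.prems(3), of \<sigma>] v by simp
  have nonneg: "0 \<le> sum_list u \<sigma>" "0 \<le> sum_list w \<sigma>" for \<sigma>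
    using in_words sum_list_nonneg_paths by (auto simp: normal_words_def)
  have "q = s \<or> rlex q s"
  proof (rule rlex_greatest_part)
    show "q \<sigma> \<le> sum_list u \<sigma> + s \<sigma>" for \<sigma> using sum[of \<sigma>] nonneg(2)[of \<sigma>] by simp
  qed (use unit_path(2,3)[OF in_words(4)] unit_path(3)[OF in_words(2)] below_last[OF snoc.prems(1)]
       in \<open>auto simp: below_def\<close>)
  moreover have "s = q \<or> rlex s q"
  proof (rule rlex_greatest_part)
    show "s \<sigma> \<le> sum_list w \<sigma> + q \<sigma>" for \<sigma> using sum[of \<sigma>] nonneg(1)[of \<sigma>] by simp
  qed (use unit_path(2,3)[OF in_words(2)] unit_path(3)[OF in_words(4)]
        below_last[OF snoc.prems(2)[unfolded v]] in \<open>auto simp: below_def\<close>)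
  ultimately have "q = s" using rlex_trans rlex_irrefl by blast
  then have "sum_list u = sum_list w" using sum by (auto simp: fun_eq_iff)
  then show ?case using snoc.IH[OF in_words(1,3)] v \<open>q = s\<close> by simp
qed

lemma standard_iff: "standard b M \<longleftrightarrow> (\<exists>u\<in>ls_words b. mset u = M)"
proof
  assume "standard b M"
  then obtain ps where ps: "set_mset M \<subseteq> LS_deg b 1" "mset ps = M"
      "successively (\<lambda>p q. max_supp p \<le> min_supp q) ps"
    unfolding standard_def by blast
  then have "ps \<in> ls_words b" unfolding normal_words_def by auto
  then show "\<exists>u\<in>ls_words b. mset u = M" using ps(2) by blast
next
  assume "\<exists>u\<in>ls_words b. mset u = M"
  then show "standard b M" unfolding standard_def normal_words_def by auto
qed

lemma canonical_form_sum_list: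
  assumes "u \<in> ls_words b"
  shows "canonical_form b (sum_list u) = mset u"
  unfolding canonical_form_def
proof (rule the_equality)
  show "standard b (mset u) \<and> path_sum (mset u) = sum_list u"
    using assms by (auto simp: standard_iff path_sum_mset)
  fix M assume M: "standard b M \<and> path_sum M = sum_list u"
  then obtain v where v: "v \<in> ls_words b" "mset v = M" unfolding standard_iff by blast
  then have "sum_list v = sum_list u" using M path_sum_mset by metis
  then show "M = mset u" using normal_word_unique[OF v(1) assms] v(2) by simp
qed

lemma LS_deg_eq: "LS_deg b r = sum_list ` {u \<in> ls_words b. length u = r}"
  using path_has_normal_word[of b r] sum_list_path[of _ b] by (auto simp: LS_deg_def image_iff) 

lemma LS_eq: "LS b = sum_list ` ls_words b"
proof -
  have "(\<Union>r. LS_deg b r) = (\<Union>r. sum_list ` {u \<in> ls_words b. length u = r})"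
    by (rule SUP_cong[OF refl LS_deg_eq])
  then show ?thesis unfolding LS_def by blast
qed

section \<open>Finitely many LS-paths of degree 1\<close>

lemma complete_chain_exists:
  fixes \<sigma> \<tau> :: "'s::{finite,order}"
  assumes "\<sigma> \<le> \<tau>"
  shows "\<exists>xs. complete_chain \<sigma> \<tau> xs"
  using assms
proof (induction "card {\<rho>. \<sigma> < \<rho> \<and> \<rho> \<le> \<tau>}" arbitrary: \<sigma> rule: less_induct)
  case less
  show ?case
  proof (cases "\<sigma> = \<tau>")
    case True
    then show ?thesis by (intro exI[of _ "[\<sigma>]"]) (simp add: complete_chain_def)
  next
    case False
    let ?S = "{\<rho>. \<sigma> < \<rho> \<and> \<rho> \<le> \<tau>}"
    have "\<tau> \<in> ?S" using False less.prems by simp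
    then obtain \<rho> where \<rho>: "\<rho> \<in> ?S" and min: "\<forall>\<rho>'\<in>?S. \<rho>' \<le> \<rho> \<longrightarrow> \<rho> = \<rho>'"
      using finite_has_minimal[of ?S] by auto
    have "covers \<rho> \<sigma>"
      unfolding covers_def
    proof (intro conjI notI)
      show "\<sigma> < \<rho>" using \<rho> by simp
      assume "\<exists>\<rho>'. \<sigma> < \<rho>' \<and> \<rho>' < \<rho>"
      then obtain \<rho>' where \<rho>': "\<sigma> < \<rho>'" "\<rho>' < \<rho>" by blast
      then have "\<rho>' \<in> ?S" using \<rho> by (auto intro: order.strict_implies_order order.strict_trans2)
      then show False using min \<rho>' by (auto simp: less_le)
    qed
    have "card {\<rho>'. \<rho> < \<rho>' \<and> \<rho>' \<le> \<tau>} < card ?S"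
    proof (rule psubset_card_mono)
      have "\<rho> \<notin> {\<rho>'. \<rho> < \<rho>' \<and> \<rho>' \<le> \<tau>}" by simp
      moreover have "{\<rho>'. \<rho> < \<rho>' \<and> \<rho>' \<le> \<tau>} \<subseteq> ?S" using \<rho> by (auto dest: order.strict_trans)
      ultimately show "{\<rho>'. \<rho> < \<rho>' \<and> \<rho>' \<le> \<tau>} \<subset> ?S" using \<rho> by blast
    qed simp
    then obtain xs where xs: "complete_chain \<rho> \<tau> xs" using less.hyps[of \<rho>] \<rho> by auto
    then have "complete_chain \<sigma> \<tau> (\<sigma> # xs)"
      using \<open>covers \<rho> \<sigma>\<close> by (auto simp: complete_chain_def successively_Cons)
    then show ?thesis by blast
  qed
qed

lemma (in poset_with_bonds) bond_positive:
  assumes "\<sigma> < \<tau>"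
  shows "0 < bond b \<sigma> \<tau>"
proof -
  obtain xs where xs: "complete_chain \<sigma> \<tau> xs" using complete_chain_exists[OF less_imp_le[OF assms]] by blast
  have "bond b \<sigma> \<tau> = chain_gcd b xs"
    unfolding bond_def using xs bond_gcd by (intro the_equality) blast+
  moreover have "chain_gcd b xs \<noteq> 0"
  proof -
    have "Suc 0 < length xs"
    proof (rule ccontr)
      assume "\<not> Suc 0 < length xs"
      then have "hd xs = last xs" using xs by (cases xs) (auto simp: complete_chain_def)
      then show False using xs assms by (auto simp: complete_chain_def)
    qed
    then have "b (xs ! 0) (xs ! Suc 0) \<in> {b (xs ! k) (xs ! Suc k) |k. Suc k < length xs}" by blast
    moreover have "0 < b (xs ! 0) (xs ! Suc 0)"
      using xs successively_nth[OF _ \<open>Suc 0 < length xs\<close>] unfolding complete_chain_def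
      by (intro bond_pos) blast
    ultimately show ?thesis unfolding chain_gcd_def Gcd_0_iff by auto
  qed
  ultimately show ?thesis by simp
qed

text \<open>The values of a unit path are differences of cumulative sums, and those have bounded denominators:
  the product of all bonds is a common one.\<close>

lemma (in poset_with_bonds) finite_unit_paths: "finite (LS_deg b 1)"
proof -
  define N where "N = (\<Prod>(\<sigma>, \<tau>)\<in>{(\<sigma>, \<tau>). \<sigma> < \<tau>}. bond b \<sigma> \<tau>)"
  have N_pos: "0 < N" unfolding N_def using bond_positive by (intro prod_pos) auto
  have N_dvd: "bond b \<sigma> \<tau> dvd N" if "\<sigma> < \<tau>" for \<sigma> \<tau>
    unfolding N_def using that dvd_prodI[of "{(\<sigma>, \<tau>). \<sigma> < \<tau>}" "(\<sigma>, \<tau>)" "\<lambda>(\<sigma>, \<tau>). bond b \<sigma> \<tau>"] by simp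
  let ?V = "(\<lambda>n. of_nat n / of_nat N :: rat) ` {..N}"
  have "\<pi> \<sigma> \<in> ?V" if \<pi>: "ls_path b 1 \<pi>" for \<pi> \<sigma>
  proof -
    note D = ls_pathD[OF \<pi>]
    have cumul: "of_nat N * cumul \<pi> \<sigma> \<in> \<int>" if \<sigma>: "\<sigma> \<in> supp \<pi>" for \<sigma>
    proof (cases "{\<tau> \<in> supp \<pi>. \<sigma> < \<tau>} = {}")
      case True
      then have "\<tau> \<le> \<sigma>" if "\<tau> \<in> supp \<pi>" for \<tau>
        using D(2) \<sigma> that unfolding totally_ordered_def by (auto simp: order.order_iff_strict)
      then show ?thesis using cumul_top[of \<pi> \<sigma>] D(3) by simp
    next
      case False
      have "totally_ordered {\<tau> \<in> supp \<pi>. \<sigma> < \<tau>}" by (rule totally_ordered_subset[OF D(2)]) auto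
      then obtain \<tau> where "\<tau> \<in> {\<tau> \<in> supp \<pi>. \<sigma> < \<tau>}"
          and min: "\<And>\<rho>. \<rho> \<in> {\<tau> \<in> supp \<pi>. \<sigma> < \<tau>} \<Longrightarrow> \<tau> \<le> \<rho>"
        using chain_has_least[OF _ False] by metis
      then have \<tau>: "\<tau> \<in> supp \<pi>" "\<sigma> < \<tau>" by auto
      have "consecutive (supp \<pi>) \<sigma> \<tau>"
        unfolding consecutive_def using \<sigma> \<tau> min by (auto dest: leD)
      then have "of_nat (bond b \<sigma> \<tau>) * cumul \<pi> \<sigma> \<in> \<int>"
        using D(4) Nats_subset_Ints by blast
      moreover obtain m where "N = bond b \<sigma> \<tau> * m" using N_dvd[OF \<tau>(2)] by (elim dvdE)
      then have "of_nat N * cumul \<pi> \<sigma> = of_nat m * (of_nat (bond b \<sigma> \<tau>) * cumul \<pi> \<sigma>)" by simp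
      ultimately show ?thesis by (metis Ints_mult Ints_of_nat)
    qed
    have int: "of_nat N * \<pi> \<sigma> \<in> \<int>"
    proof (cases "\<sigma> \<in> supp \<pi>")
      case True
      have "of_nat N * (\<Sum>\<rho> | \<rho> < \<sigma>. \<pi> \<rho>) \<in> \<int>"
        using sum_below_cases[OF D(2), of \<sigma>] cumul by (metis Ints_0 mult_zero_right)
      moreover have "of_nat N * \<pi> \<sigma> = of_nat N * cumul \<pi> \<sigma> - of_nat N * (\<Sum>\<rho> | \<rho> < \<sigma>. \<pi> \<rho>)"
        by (simp add: cumul_split algebra_simps)
      ultimately show ?thesis using cumul[OF True] by (metis Ints_diff)
    next
      case False
      then show ?thesis by (simp add: supp_def)
    qed
    have "\<pi> \<sigma> \<le> (\<Sum>\<rho>\<in>UNIV. \<pi> \<rho>)" using D(1) by (intro member_le_sum) auto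
    then have le1: "\<pi> \<sigma> \<le> 1" using D(3) by simp
    have "of_nat N * \<pi> \<sigma> \<in> \<nat>" using int D(1) by (simp add: Nats_altdef2)
    then obtain n where n: "of_nat N * \<pi> \<sigma> = of_nat n" by (elim Nats_cases)
    then have "(of_nat n :: rat) \<le> of_nat N" using le1 by (metis mult.right_neutral mult_left_mono of_nat_0_le_iff)
    then have "n \<in> {..N}" by simp
    moreover have "\<pi> \<sigma> = of_nat n / of_nat N" using n N_pos by (simp add: field_simps)
    ultimately show ?thesis by blast
  qed
  then have "LS_deg b 1 \<subseteq> {f. \<forall>\<sigma>. (\<sigma> \<in> UNIV \<longrightarrow> f \<sigma> \<in> ?V) \<and> (\<sigma> \<notin> UNIV \<longrightarrow> f \<sigma> = 0)}"
    by (auto simp: LS_deg_def)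
  then show ?thesis
    by (rule finite_subset) (intro finite_set_of_finite_funs; simp)
qed

section \<open>LS algebras have a basis of normal words\<close>

context ls_algebra
begin

lemma value_eq_path_value:
  assumes "u \<in> ls_words b"
  shows "word_value j u = path_value b j (sum_list u)"
  unfolding path_value_def canonical_form_sum_list[OF assms]
  by (simp add: word_value_def monomial_value_def prod_mset_prod_list flip: mset_map)

lemma values_eq:
  assumes "V \<subseteq> ls_words b"
  shows "word_value j ` V = path_value b j ` sum_list ` V"
  unfolding image_image using assms value_eq_path_value by (intro image_cong) auto

lemma inj_word_value: "inj_on (word_value j) (ls_words b)"
proof (rule inj_onI)
  fix u v assume uv: "u \<in> ls_words b" "v \<in> ls_words b" "word_value j u = word_value j v"
  then have "path_value b j (sum_list u) = path_value b j (sum_list v)"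
    using value_eq_path_value by metis
  then have "sum_list u = sum_list v"
    using uv by (intro inj_onD[OF LSA1_inj]) (auto simp: LS_eq)
  then show "u = v" by (rule normal_word_unique[OF uv(1,2)])
qed

lemma component_words:
  "ls_component scale b j n = span (word_value j ` {u \<in> ls_words b. length u = n})"
  unfolding ls_component_def by (subst LS_deg_eq[of b n], subst values_eq) auto

text \<open>Two cases. If only the order of the letters is wrong, swapping them keeps the sum and moves the larger letter to
  the end. Otherwise the pair is a non-standard monomial. Its straightening relation involves pairs whose sum is
  larger, or pairs with the same sum, whose last letter is then greater than \<open>q\<close>.\<close>

lemma straighten_words:
  assumes p: "p \<in> LS_deg b 1" and q: "q \<in> LS_deg b 1" and bad: "\<not> max_supp p \<le> min_supp q"
  shows "j p * j q \<in> span (word_value j ` {u \<in> ls_words b. word_less u [p, q]})"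
    (is "_ \<in> span (word_value j ` ?L)")
proof (cases "max_supp q \<le> min_supp p")
  case True
  have "q = p \<or> rlex q p"
    using True max_le_min_iff_below[OF q p] unit_path(2,3)[OF q] unit_path(2,3)[OF p]
    by (intro rlex_greatest_part[of q q p]) (auto simp: below_def)
  then have "rlex q p" using True bad by blast
  then have "word_less [q, p] [p, q]"
    by (simp add: word_less_def add.commute)
  moreover have "[q, p] \<in> ls_words b" using p q True by (simp add: normal_words_def)
  ultimately have "word_value j [q, p] \<in> span (word_value j ` ?L)"
    by (intro span_base imageI) simp
  then show ?thesis by (simp add: mult.commute)
next
  case False
  interpret graded: graded_comm_algebra scale "ls_component scale b j" by (rule LSA1_grading)
  let ?V = "{u \<in> ls_words b. length u = 2}"
  have V: "?V \<subseteq> ls_words b" by auto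
  have inj_V: "inj_on (word_value j) ?V" using inj_word_value by (rule inj_on_subset) auto
  have fin_V: "finite ?V"
    by (rule finite_subset[OF _ finite_lists_length_eq[OF finite_unit_paths, of 2]])
      (auto simp: normal_words_def)
  have "j r \<in> ls_component scale b j 1" if "r \<in> LS_deg b 1" for r
  proof -
    have "word_value j [r] \<in> ls_component scale b j 1"
      unfolding component_words using that by (intro span_base imageI) (simp add: normal_words_def)
    then show ?thesis by simp
  qed
  then have "j p * j q \<in> ls_component scale b j (1 + 1)"
    using p q by (intro graded.mult_component)
  then have "j p * j q \<in> span (word_value j ` ?V)"
    unfolding component_words by (simp only: one_add_one)
  then obtain g where g: "j p * j q = (\<Sum>v\<in>word_value j ` ?V. scale (g v) v)"
    using fin_V by (auto simp: span_finite)
  \<comment> \<open>The coefficients are transported from the values of the words to the multisets.\<close>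
  define c where "c M = (if M \<in> mset ` ?V then g (monomial_value j M) else 0)" for M
  have value_mset: "word_value j u = monomial_value j (mset u)" for u
    by (simp add: word_value_def monomial_value_def prod_mset_prod_list flip: mset_map)
  have inj_mset: "inj_on mset ?V"
  proof (rule inj_onI)
    fix u v assume uv: "u \<in> ?V" "v \<in> ?V" "mset u = mset v"
    then have "sum_list u = sum_list v" by (metis path_sum_mset)
    then show "u = v" using uv by (intro normal_word_unique[of u b v]) auto
  qed
  have expansion: "j p * j q = (\<Sum>u\<in>?V. scale (c (mset u)) (word_value j u))"
    unfolding g sum.reindex[OF inj_V] by (intro sum.cong) (auto simp: c_def value_mset)
  also have "\<dots> = (\<Sum>M\<in>mset ` ?V. scale (c M) (monomial_value j M))"
    by (simp add: sum.reindex[OF inj_mset] value_mset)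
  also have "\<dots> = (\<Sum>M | c M \<noteq> 0. scale (c M) (monomial_value j M))"
    using fin_V by (intro sum.mono_neutral_right) (auto simp: c_def)
  finally have straightening: "straightening scale b j p q c"
    unfolding straightening_def using fin_V
    by (auto simp: c_def standard_iff intro: finite_subset[of _ "mset ` ?V"])
  have nonstandard: "\<not> standard b {#p, q#}"
  proof
    assume "standard b {#p, q#}"
    then obtain u where u: "u \<in> ls_words b" "mset u = {#p, q#}" by (auto simp: standard_iff)
    then have "size (mset u) = 2" by simp
    then obtain r s where rs: "u = [r, s]" by (auto simp: length_Suc_conv numeral_2_eq_2)
    then have "r = p \<and> s = q \<or> r = q \<and> s = p" using u(2) by (auto simp: add_eq_conv_ex)
    then show False using u(1) rs bad False by (auto simp: normal_words_def)
  qed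
  have less: "word_less u [p, q]" if u: "u \<in> ?V" and cu: "c (mset u) \<noteq> 0" for u
  proof -
    obtain r s where rs: "u = [r, s]" using u by (auto simp: length_Suc_conv numeral_2_eq_2)
    have rs_in: "r \<in> LS_deg b 1" "s \<in> LS_deg b 1" and good: "max_supp r \<le> min_supp s"
      using u rs by (auto simp: normal_words_def)
    have "path_le (path_sum {#p, q#}) (path_sum (mset u))"
      by (rule LSA2[OF p q nonstandard straightening cu])
    moreover have "path_sum {#p, q#} = sum_list [p, q]"
      using path_sum_mset[of "[p, q]"] by simp
    ultimately have "sum_list [p, q] = sum_list u \<or> rlex (sum_list [p, q]) (sum_list u)"
      using path_le_imp_rlex path_sum_mset by metis
    then show ?thesis
    proof
      assume eq: "sum_list [p, q] = sum_list u"
      have sum: "p \<sigma> + q \<sigma> = r \<sigma> + s \<sigma>" for \<sigma> using fun_cong[OF eq, of \<sigma>] rs by simp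
      have "q = s \<or> rlex q s"
      proof (rule rlex_greatest_part)
        show "q \<sigma> \<le> r \<sigma> + s \<sigma>" for \<sigma> using sum[of \<sigma>] unit_path(2)[OF p, of \<sigma>] by simp
      qed (use good max_le_min_iff_below[OF rs_in] unit_path(2,3)[OF q] unit_path(3)[OF rs_in(2)]
           in \<open>auto simp: below_def\<close>)
      moreover have "q \<noteq> s"
      proof
        assume "q = s"
        then have "p = r" using sum by (auto simp: fun_eq_iff)
        then show False using \<open>q = s\<close> good bad by simp
      qed
      ultimately show ?thesis using eq rs by (simp add: word_less_def)
    next
      assume "rlex (sum_list [p, q]) (sum_list u)"
      then show ?thesis using rs by (simp add: word_less_def)
    qed
  qed
  have "(\<Sum>u\<in>?V. scale (c (mset u)) (word_value j u)) \<in> span (word_value j ` ?L)"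
  proof (rule span_sum)
    fix u assume u: "u \<in> ?V"
    show "scale (c (mset u)) (word_value j u) \<in> span (word_value j ` ?L)"
    proof (cases "c (mset u) = 0")
      case True
      then show ?thesis by (simp add: span_zero)
    next
      case False
      then show ?thesis using less[OF u] u by (intro span_scale span_base imageI) simp
    qed
  qed
  then show ?thesis unfolding expansion .
qed

lemma pbw: "pbw_algebra scale (ls_component scale b j) (LS_deg b 1) j
    (\<lambda>p q. max_supp p \<le> min_supp q) word_less"
proof -
  interpret graded: graded_comm_algebra scale "ls_component scale b j" by (rule LSA1_grading)
  show ?thesis
  proof unfold_locales
    show "finite (LS_deg b 1)" by (rule finite_unit_paths)
    show "\<not> word_less u u" for u :: "('s \<Rightarrow> rat) list"
      by (simp add: word_less_def rlex_irrefl)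
    show "word_less u v \<Longrightarrow> word_less v w \<Longrightarrow> word_less u w" for u v w :: "('s \<Rightarrow> rat) list"
      unfolding word_less_def using rlex_trans by metis
    show "word_less u v \<Longrightarrow> length u = length v" for u v :: "('s \<Rightarrow> rat) list"
      by (simp add: word_less_def)
    show "word_less u v \<Longrightarrow> word_less (a @ u @ c) (a @ v @ c)" for u v a c :: "('s \<Rightarrow> rat) list"
      by (rule word_less_context)
    show "inj_on (word_value j) (ls_words b)" by (rule inj_word_value)
    have "word_value j ` ls_words b = path_value b j ` LS b"
      unfolding LS_eq by (rule values_eq) simp
    then show "independent (word_value j ` ls_words b)" "span (word_value j ` ls_words b) = UNIV"
      using LSA1_independent LSA1_span by auto
    show "ls_component scale b j n = span (word_value j ` {u \<in> ls_words b. length u = n})" for n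
      by (rule component_words)
    show "p \<in> LS_deg b 1 \<Longrightarrow> q \<in> LS_deg b 1 \<Longrightarrow> \<not> max_supp p \<le> min_supp q \<Longrightarrow>
        j p * j q \<in> span (word_value j ` {u \<in> ls_words b. word_less u [p, q]})" for p q
      by (rule straighten_words)
  qed
qed

end

theorem theorem0p8p2:
  fixes scale :: "'k::field \<Rightarrow> 'a::comm_ring_1 \<Rightarrow> 'a"
    and b :: "'s::{finite,order} \<Rightarrow> 's \<Rightarrow> nat"
    and j :: "('s \<Rightarrow> rat) \<Rightarrow> 'a"
  assumes "ls_algebra scale b j"
  shows "koszul scale (ls_component scale b j)"
  using pbw_algebra.koszul[OF ls_algebra.pbw[OF assms]] .

end
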